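(* Let $f$ and $g$ be positive regular free holomorphic functions with $n$ indeterminates and let $m,l\ge1$, with $\mathbf D_f^m(\mathcal H)$ and $\mathbf D_g^l(\mathcal H)$ norm-closed and starlike. Let $F=(F_1,\dots,F_n)$ and $G=(G_1,\dots,G_n)$ be $n$-tuples of formal power series in $n$ noncommuting indeterminates such that $$F(0)=G(0)=0\quad\text{and}\quad F\circ G=G\circ F=\mathrm{id}.$$ If $F(\mathbf D_{f,\mathrm{nil}}^m(\mathcal H))=\mathbf D_{g,\mathrm{nil}}^l(\mathcal H)$ for any Hilbert space $\mathcal H$, then $F$ has the form $$F(Z_1,\dots,Z_n)=[Z_1,\dots,Z_n]U,$$ where $U$ is an invertible bounded linear operator on $\mathbb C^n$.
   Context: $\mathbb F_n^+$ is the free monoid on generators $g_1,\dots,g_n$ with identity $g_0$; $|\alpha|$ is the length of $\alpha$. For $X\in B(\mathcal H)^n$ and $\alpha=g_{i_1}\cdots g_{i_k}$, $X_\alpha:=X_{i_1}\cdots X_{i_k}$, $X_{g_0}:=I$ (same for indeterminates $Z_i$). Formal power series have complex coefficients; $F(0)=0$ means the constant terms vanish, so the compositions are well defined formal power series, and $\mathrm{id}=(Z_1,\dots,Z_n)$. A positive regular free holomorphic function in $n$ indeterminates is a formal power series $f=\sum_{|\alpha|\ge1}a_\alpha X_\alpha$ with $a_\alpha\ge0$, $a_{g_i}>0$ for $i=1,\dots,n$, and $\limsup_{k\to\infty}(\sum_{|\alpha|=k}|a_\alpha|^2)^{1/2k}<\infty$. For $m\ge1$ and a Hilbert space $\mathcal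 H$, $$\mathbf D_f^m(\mathcal H):=\{X\in B(\mathcal H)^n:\ (id-\Phi_{f,X})^k(I)\ge0,\ 1\le k\le m\},\qquad \Phi_{f,X}(Y):=\sum_{k=1}^\infty\sum_{|\alpha|=k}a_\alpha X_\alpha YX_\alpha^*$$ (weak operator convergence). Standing assumption: $\mathbf D_f^m(\mathcal H)$ and $\mathbf D_g^l(\mathcal H)$ ($\mathcal H$ separable infinite dimensional) are closed in the operator norm and starlike (stable under multiplication by $r\in[0,1)$). A tuple $(N_1,\dots,N_n)\in B(\mathcal H)^n$ is nilpotent if there is $p\in\mathbb N=\{1,2,\dots\}$ with $N_\alpha=0$ for all $|\alpha|=p$; $\mathbf D_{f,\mathrm{nil}}^m(\mathcal H)$ is the set of nilpotent tuples in $\mathbf D_f^m(\mathcal H)$. A formal power series is evaluated at a nilpotent tuple by the resulting finite sum. For $U=[a_{ij}]_{n\times n}$, $[X_1,\dots,X_n]U:=(\sum_{i=1}^na_{i1}X_i,\dots,\sum_{i=1}^na_{in}X_i)$. *)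

theory Defs
  imports
    "HOL-Analysis.Analysis"
    "HOL-Algebra.Module"
begin

section \<open>Complex Hilbert spaces\<close>

text \<open>
  The main theorem has a hypothesis about every Hilbert space, so Hilbert spaces are
  structures with a carrier (over which one can quantify), not types. The
  multiplicative fields \<open>mult\<close> and \<open>one\<close> that a module record inherits from rings are unused,
  as everywhere in HOL-Algebra.
\<close>

definition complex_ring :: "complex ring" where
  "complex_ring = \<lparr>carrier = UNIV, mult = (*), one = 1, zero = 0, add = (+)\<rparr>"

record 'h hilbert = "(complex, 'h) module" +
  hinner :: "'h \<Rightarrow> 'h \<Rightarrow> complex"

definition hnorm :: "'h hilbert \<Rightarrow> 'h \<Rightarrow> real" where
  "hnorm H x = sqrt (Re (hinner H x x))"

locale complex_hilbert_space = Module.module complex_ring H for H :: "'h hilbert" +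
  assumes hinner_add_left:
      "\<lbrakk>x \<in> carrier H; y \<in> carrier H; z \<in> carrier H\<rbrakk> \<Longrightarrow>
        hinner H (x \<oplus>\<^bsub>H\<^esub> y) z = hinner H x z + hinner H y z"
    and hinner_scale_left:
      "\<lbrakk>x \<in> carrier H; y \<in> carrier H\<rbrakk> \<Longrightarrow> hinner H (c \<odot>\<^bsub>H\<^esub> x) y = c * hinner H x y"
    and hinner_cnj:
      "\<lbrakk>x \<in> carrier H; y \<in> carrier H\<rbrakk> \<Longrightarrow> hinner H y x = cnj (hinner H x y)"
    and hinner_nonneg:
      "x \<in> carrier H \<Longrightarrow> hinner H x x \<in> \<real>\<^sub>\<ge>\<^sub>0"
    and hinner_definite:
      "\<lbrakk>x \<in> carrier H; hinner H x x = 0\<rbrakk> \<Longrightarrow> x = \<zero>\<^bsub>H\<^esub>"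
    and complete:
      "\<lbrakk>\<And>k :: nat. s k \<in> carrier H;
        \<And>e :: real. e > 0 \<Longrightarrow> \<exists>K. \<forall>j\<ge>K. \<forall>k\<ge>K. hnorm H (s j \<ominus>\<^bsub>H\<^esub> s k) < e\<rbrakk> \<Longrightarrow>
        \<exists>x\<in>carrier H. (\<lambda>k. hnorm H (s k \<ominus>\<^bsub>H\<^esub> x)) \<longlonglongrightarrow> 0"

definition separable_hilbert :: "'h hilbert \<Rightarrow> bool" where
  "separable_hilbert H \<longleftrightarrow>
    (\<exists>D. countable D \<and> D \<subseteq> carrier H \<and>
      (\<forall>x\<in>carrier H. \<forall>e>0. \<exists>d\<in>D. hnorm H (x \<ominus>\<^bsub>H\<^esub> d) < e))"

definition infinite_dimensional :: "'h hilbert \<Rightarrow> bool" where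
  "infinite_dimensional H \<longleftrightarrow>
    \<not> (\<exists>B. finite B \<and> B \<subseteq> carrier H \<and>
        (\<forall>x\<in>carrier H. \<exists>c. x = (\<Oplus>\<^bsub>H\<^esub>b\<in>B. c b \<odot>\<^bsub>H\<^esub> b)))"


section \<open>Bounded operators\<close>

text \<open>
  Operators are extensional functions (\<^const>\<open>undefined\<close> off the carrier), so that operators
  agreeing on the carrier are equal.
\<close>

definition bounded_ops :: "'h hilbert \<Rightarrow> ('h \<Rightarrow> 'h) set" where
  "bounded_ops H = {T \<in> carrier H \<rightarrow>\<^sub>E carrier H.
     (\<forall>x\<in>carrier H. \<forall>y\<in>carrier H. T (x \<oplus>\<^bsub>H\<^esub> y) = T x \<oplus>\<^bsub>H\<^esub> T y) \<and>
     (\<forall>c. \<forall>x\<in>carrier H. T (c \<odot>\<^bsub>H\<^esub> x) = c \<odot>\<^bsub>H\<^esub> T x) \<and>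
     (\<exists>C. \<forall>x\<in>carrier H. hnorm H (T x) \<le> C * hnorm H x)}"

definition op_id :: "'h hilbert \<Rightarrow> 'h \<Rightarrow> 'h" where
  "op_id H = (\<lambda>x\<in>carrier H. x)"

definition op_zero :: "'h hilbert \<Rightarrow> 'h \<Rightarrow> 'h" where
  "op_zero H = (\<lambda>x\<in>carrier H. \<zero>\<^bsub>H\<^esub>)"

definition op_diff :: "'h hilbert \<Rightarrow> ('h \<Rightarrow> 'h) \<Rightarrow> ('h \<Rightarrow> 'h) \<Rightarrow> 'h \<Rightarrow> 'h" where
  "op_diff H S T = (\<lambda>x\<in>carrier H. S x \<ominus>\<^bsub>H\<^esub> T x)"

definition op_scale :: "'h hilbert \<Rightarrow> complex \<Rightarrow> ('h \<Rightarrow> 'h) \<Rightarrow> 'h \<Rightarrow> 'h" where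
  "op_scale H c T = (\<lambda>x\<in>carrier H. c \<odot>\<^bsub>H\<^esub> T x)"

definition op_norm :: "'h hilbert \<Rightarrow> ('h \<Rightarrow> 'h) \<Rightarrow> real" where
  "op_norm H T = (SUP x\<in>{x \<in> carrier H. hnorm H x \<le> 1}. hnorm H (T x))"

definition op_adjoint :: "'h hilbert \<Rightarrow> ('h \<Rightarrow> 'h) \<Rightarrow> 'h \<Rightarrow> 'h" where
  "op_adjoint H T = (THE S. S \<in> bounded_ops H \<and>
     (\<forall>x\<in>carrier H. \<forall>y\<in>carrier H. hinner H (T x) y = hinner H x (S y)))"

definition op_nonneg :: "'h hilbert \<Rightarrow> ('h \<Rightarrow> 'h) \<Rightarrow> bool" where
  "op_nonneg H T \<longleftrightarrow> (\<forall>x\<in>carrier H. hinner H (T x) x \<in> \<real>\<^sub>\<ge>\<^sub>0)"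

text \<open>
  The free monoid on \<open>n = CARD('n)\<close> generators is \<^typ>\<open>'n list\<close>, with \<open>[]\<close> as \<open>g\<^sub>0\<close>.
\<close>

definition op_word :: "'h hilbert \<Rightarrow> ('n \<Rightarrow> 'h \<Rightarrow> 'h) \<Rightarrow> 'n list \<Rightarrow> 'h \<Rightarrow> 'h" where
  "op_word H X \<alpha> = foldr (\<lambda>i T. compose (carrier H) (X i) T) \<alpha> (op_id H)"


section \<open>Noncommutative domains\<close>

definition positive_regular :: "('n::finite list \<Rightarrow> real) \<Rightarrow> bool" where
  "positive_regular a \<longleftrightarrow>
     a [] = 0 \<and> (\<forall>\<alpha>. a \<alpha> \<ge> 0) \<and> (\<forall>i. a [i] > 0) \<and>
     limsup (\<lambda>k. ereal (root (2 * k) (\<Sum>\<alpha> | length \<alpha> = k. \<bar>a \<alpha>\<bar>\<^sup>2))) < \<infinity>"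

text \<open>
  \<open>is_Phi H a X Y Z\<close> says that the series defining \<open>\<Phi>\<^bsub>f,X\<^esub>(Y)\<close> converges in the weak
  operator topology to \<open>Z\<close>; the summation index is shifted as the series starts at \<open>k = 1\<close>.
\<close>

definition is_Phi ::
  "'h hilbert \<Rightarrow> ('n::finite list \<Rightarrow> real) \<Rightarrow> ('n \<Rightarrow> 'h \<Rightarrow> 'h) \<Rightarrow> ('h \<Rightarrow> 'h) \<Rightarrow> ('h \<Rightarrow> 'h) \<Rightarrow> bool"
  where
  "is_Phi H a X Y Z \<longleftrightarrow> Z \<in> bounded_ops H \<and>
     (\<forall>x\<in>carrier H. \<forall>y\<in>carrier H.
       (\<lambda>k. \<Sum>\<alpha> | length \<alpha> = Suc k.
          of_real (a \<alpha>) *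
          hinner H (op_word H X \<alpha> (Y (op_adjoint H (op_word H X \<alpha>) x))) y)
       sums hinner H (Z x) y)"

definition Phi ::
  "'h hilbert \<Rightarrow> ('n::finite list \<Rightarrow> real) \<Rightarrow> ('n \<Rightarrow> 'h \<Rightarrow> 'h) \<Rightarrow> ('h \<Rightarrow> 'h) \<Rightarrow> 'h \<Rightarrow> 'h"
  where
  "Phi H a X Y = (THE Z. is_Phi H a X Y Z)"

text \<open>
  Membership in \<open>\<^bold>D\<^sub>f\<^sup>m(H)\<close> includes that \<open>\<Phi>\<^bsub>f,X\<^esub>\<close> is well defined on all of \<open>B(H)\<close>.
\<close>

definition nc_domain ::
  "'h hilbert \<Rightarrow> ('n::finite list \<Rightarrow> real) \<Rightarrow> nat \<Rightarrow> ('n \<Rightarrow> 'h \<Rightarrow> 'h) set" where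
  "nc_domain H a m = {X. (\<forall>i. X i \<in> bounded_ops H) \<and>
     (\<forall>Y\<in>bounded_ops H. \<exists>Z. is_Phi H a X Y Z) \<and>
     (\<forall>k\<in>{1..m}. op_nonneg H (((\<lambda>Y. op_diff H Y (Phi H a X Y)) ^^ k) (op_id H)))}"

definition nilpotent_tuple :: "'h hilbert \<Rightarrow> ('n \<Rightarrow> 'h \<Rightarrow> 'h) \<Rightarrow> bool" where
  "nilpotent_tuple H N \<longleftrightarrow> (\<exists>p\<ge>1. \<forall>\<alpha>. length \<alpha> = p \<longrightarrow> op_word H N \<alpha> = op_zero H)"

definition nc_domain_nil ::
  "'h hilbert \<Rightarrow> ('n::finite list \<Rightarrow> real) \<Rightarrow> nat \<Rightarrow> ('n \<Rightarrow> 'h \<Rightarrow> 'h) set" where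
  "nc_domain_nil H a m = {N \<in> nc_domain H a m. nilpotent_tuple H N}"

text \<open>Since \<open>B(H)\<^sup>n\<close> is metrizable, closed means sequentially closed.\<close>

definition norm_closed :: "'h hilbert \<Rightarrow> ('n \<Rightarrow> 'h \<Rightarrow> 'h) set \<Rightarrow> bool" where
  "norm_closed H D \<longleftrightarrow>
     (\<forall>s X. (\<forall>k :: nat. s k \<in> D) \<and> (\<forall>i. X i \<in> bounded_ops H) \<and>
        (\<forall>i. (\<lambda>k. op_norm H (op_diff H (s k i) (X i))) \<longlonglongrightarrow> 0) \<longrightarrow> X \<in> D)"

definition starlike_ops :: "'h hilbert \<Rightarrow> ('n \<Rightarrow> 'h \<Rightarrow> 'h) set \<Rightarrow> bool" where
  "starlike_ops H D \<longleftrightarrow>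
     (\<forall>X\<in>D. \<forall>r::real. 0 \<le> r \<and> r < 1 \<longrightarrow> (\<lambda>i. op_scale H (of_real r) (X i)) \<in> D)"


section \<open>Formal power series in noncommuting indeterminates\<close>

type_synonym 'n ncps = "'n list \<Rightarrow> complex"

definition ncps_one :: "'n ncps" where
  "ncps_one = (\<lambda>\<alpha>. if \<alpha> = [] then 1 else 0)"

definition ncps_var :: "'n \<Rightarrow> 'n ncps" where
  "ncps_var i = (\<lambda>\<alpha>. if \<alpha> = [i] then 1 else 0)"

definition ncps_mult :: "'n ncps \<Rightarrow> 'n ncps \<Rightarrow> 'n ncps" where
  "ncps_mult p q = (\<lambda>\<alpha>. \<Sum>k\<le>length \<alpha>. p (take k \<alpha>) * q (drop k \<alpha>))"

definition ncps_word :: "('n \<Rightarrow> 'n ncps) \<Rightarrow> 'n list \<Rightarrow> 'n ncps" where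
  "ncps_word G \<alpha> = foldr (\<lambda>i p. ncps_mult (G i) p) \<alpha> ncps_one"

text \<open>
  The coefficient of \<open>\<beta>\<close> in \<open>F\<^sub>i \<circ> G = \<Sum>\<^sub>\<alpha> F\<^sub>i(\<alpha>) G\<^sub>\<alpha>\<close>. The restriction to
  \<open>|\<alpha>| \<le> |\<beta>|\<close> only removes terms which vanish when \<open>G(0) = 0\<close>, see the lemma below.
\<close>

definition ncps_compose ::
  "('n::finite \<Rightarrow> 'n ncps) \<Rightarrow> ('n \<Rightarrow> 'n ncps) \<Rightarrow> 'n \<Rightarrow> 'n ncps" where
  "ncps_compose F G i = (\<lambda>\<beta>. \<Sum>\<alpha> | length \<alpha> \<le> length \<beta>. F i \<alpha> * ncps_word G \<alpha> \<beta>)"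

lemma ncps_word_eq_0:
  assumes "\<And>i. G i [] = 0" and "length \<beta> < length \<alpha>"
  shows "ncps_word G \<alpha> \<beta> = 0"
  using assms(2)
proof (induction \<alpha> arbitrary: \<beta>)
  case (Cons i \<alpha>)
  have "G i (take k \<beta>) * ncps_word G \<alpha> (drop k \<beta>) = 0" for k
  proof (cases "take k \<beta> = []")
    case True
    then show ?thesis by (simp only: assms(1) mult_zero_left)
  next
    case False
    then have "length (drop k \<beta>) < length \<alpha>"
      using Cons.prems by (cases k; cases \<beta>) auto
    then show ?thesis using Cons.IH by simp
  qed
  then have "(\<Sum>k\<le>length \<beta>. G i (take k \<beta>) * ncps_word G \<alpha> (drop k \<beta>)) = 0"
    by (intro sum.neutral ballI)
  then show ?case by (simp add: ncps_word_def ncps_mult_def)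
qed simp

text \<open>Evaluation at a nilpotent tuple; only finitely many words of such a tuple are nonzero.\<close>

definition ncps_eval ::
  "'h hilbert \<Rightarrow> ('n::finite \<Rightarrow> 'n ncps) \<Rightarrow> ('n \<Rightarrow> 'h \<Rightarrow> 'h) \<Rightarrow> 'n \<Rightarrow> 'h \<Rightarrow> 'h" where
  "ncps_eval H F N i = (\<lambda>x\<in>carrier H.
     \<Oplus>\<^bsub>H\<^esub>\<alpha>\<in>{\<alpha>. op_word H N \<alpha> \<noteq> op_zero H}. F i \<alpha> \<odot>\<^bsub>H\<^esub> op_word H N \<alpha> x)"

definition ncps_row_mult :: "('n::finite \<Rightarrow> 'n ncps) \<Rightarrow> complex^'n^'n \<Rightarrow> 'n \<Rightarrow> 'n ncps" where
  "ncps_row_mult F U j = (\<lambda>\<alpha>. \<Sum>i\<in>UNIV. U $ i $ j * F i \<alpha>)"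

end

theory Submission
  imports Defs
begin

text \<open>
  This is Cartan's linearity argument. For \<open>|c| = 1\<close> both nilpotent domains are stable under
  multiplication by \<open>c\<close>, so \<open>T = c\<inverse> G \<circ> (c F)\<close> maps \<open>\<^bold>D\<^bsub>f,nil\<^esub>\<close> into itself, and \<open>T\<close> agrees
  with the identity up to degree 1. If \<open>T\<^sub>i\<close> had a coefficient \<open>t \<noteq> 0\<close> at a word \<open>\<beta>\<close> of minimal length
  \<open>q \<ge> 2\<close>, then the \<open>k\<close>-th iterate of \<open>T\<close> would have the coefficient \<open>k t\<close> there. A small multiple \<open>r M\<close>
  of the shift \<open>M\<close> along \<open>\<beta>\<close> on \<open>\<complex>\<^bsup>q+1\<^esup>\<close> lies in the domain and reads this coefficient off as a
  matrix entry \<open>k t r\<^sup>q\<close>, but the entries of all tuples in the domain are uniformly bounded.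
  Hence \<open>T = id\<close>, so \<open>F(c N) = c F(N)\<close>, and the same shifts turn this into \<open>c\<^sup>q a = c a\<close> for every
  coefficient \<open>a\<close> of \<open>F\<close> at a word of length \<open>q\<close>. Choosing \<open>c\<close> with \<open>c\<^bsup>q-1\<^esup> = -1\<close> kills all coefficients
  with \<open>q \<ge> 2\<close>.
\<close>

section \<open>Operators on complex Hilbert spaces\<close>

lemma complex_ring_simps [simp]:
  "carrier complex_ring = UNIV" "x \<oplus>\<^bsub>complex_ring\<^esub> y = x + y"
  "x \<otimes>\<^bsub>complex_ring\<^esub> y = x * y" "\<zero>\<^bsub>complex_ring\<^esub> = 0" "\<one>\<^bsub>complex_ring\<^esub> = 1"
  by (simp_all add: complex_ring_def)

context complex_hilbert_space
begin

section \<open>Inner product, norm and the Cauchy-Schwarz inequality\<close>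

lemma smult_carrier [simp, intro]: "x \<in> carrier H \<Longrightarrow> c \<odot>\<^bsub>H\<^esub> x \<in> carrier H"
  by (rule smult_closed) auto

lemma hinner_scale_right:
  assumes "x \<in> carrier H" "y \<in> carrier H"
  shows "hinner H x (c \<odot>\<^bsub>H\<^esub> y) = cnj c * hinner H x y"
  using assms by (metis smult_carrier complex_cnj_mult hinner_scale_left hinner_cnj)

lemma hinner_zero_left [simp]: "y \<in> carrier H \<Longrightarrow> hinner H \<zero>\<^bsub>H\<^esub> y = 0"
  using hinner_add_left[of "\<zero>\<^bsub>H\<^esub>" "\<zero>\<^bsub>H\<^esub>" y] by simp

lemma hinner_zero_right [simp]: "y \<in> carrier H \<Longrightarrow> hinner H y \<zero>\<^bsub>H\<^esub> = 0"
  using hinner_cnj[of "\<zero>\<^bsub>H\<^esub>" y] by simp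

lemma hinner_diff_left:
  assumes "x \<in> carrier H" "y \<in> carrier H" "z \<in> carrier H"
  shows "hinner H (x \<ominus>\<^bsub>H\<^esub> y) z = hinner H x z - hinner H y z"
proof -
  have "hinner H (x \<ominus>\<^bsub>H\<^esub> y) z + hinner H y z = hinner H ((x \<ominus>\<^bsub>H\<^esub> y) \<oplus>\<^bsub>H\<^esub> y) z"
    using assms by (simp add: hinner_add_left)
  also have "(x \<ominus>\<^bsub>H\<^esub> y) \<oplus>\<^bsub>H\<^esub> y = x"
    using assms by (simp add: M.minus_eq M.a_assoc M.l_neg)
  finally show ?thesis by (simp add: algebra_simps)
qed

lemma hinner_diff_right:
  assumes "x \<in> carrier H" "y \<in> carrier H" "z \<in> carrier H"
  shows "hinner H x (y \<ominus>\<^bsub>H\<^esub> z) = hinner H x y - hinner H x z"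
  using assms by (metis M.minus_closed complex_cnj_diff hinner_cnj hinner_diff_left)

text \<open>Pairing the difference with itself makes its norm vanish. Most vector identities below
  are checked this way, as scalar identities under the inner product.\<close>

lemma vector_eqI:
  assumes "x \<in> carrier H" "y \<in> carrier H"
    and "\<And>z. z \<in> carrier H \<Longrightarrow> hinner H x z = hinner H y z"
  shows "x = y"
proof -
  have "hinner H (x \<ominus>\<^bsub>H\<^esub> y) (x \<ominus>\<^bsub>H\<^esub> y) = 0"
    using assms by (simp add: hinner_diff_left)
  then have "x \<ominus>\<^bsub>H\<^esub> y = \<zero>\<^bsub>H\<^esub>" using assms by (intro hinner_definite) auto
  moreover have "(x \<ominus>\<^bsub>H\<^esub> y) \<oplus>\<^bsub>H\<^esub> y = x"
    using assms by (simp add: M.minus_eq M.a_assoc M.l_neg)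
  ultimately show ?thesis using assms by simp
qed

lemma hinner_self: 
  assumes "x \<in> carrier H" shows "hinner H x x = of_real ((hnorm H x)\<^sup>2)"
  using hinner_nonneg[OF assms]
  by (auto simp: hnorm_def complex_nonneg_Reals_iff complex_eq_iff)

lemma hnorm_nonneg: "x \<in> carrier H \<Longrightarrow> 0 \<le> hnorm H x"
  using hinner_nonneg[of x] by (auto simp: hnorm_def complex_nonneg_Reals_iff)

lemma Cauchy_Schwarz:
  assumes x: "x \<in> carrier H" and y: "y \<in> carrier H"
  shows "cmod (hinner H x y) \<le> hnorm H x * hnorm H y"
proof (cases "hnorm H y = 0")
  case True
  then have "hinner H y y = 0" using hinner_self[OF y] by simp
  then have "y = \<zero>\<^bsub>H\<^esub>" using hinner_definite[OF y] by blast
  then show ?thesis using True x by simp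
next
  case False
  define a where "a = (hnorm H y)\<^sup>2"
  define b where "b = hinner H x y"
  \<comment> \<open>\<open>z\<close> is |y|^2 times the component of x orthogonal to y; the factor
    |y|^2 avoids a division. Nonnegativity of <z, z> is the inequality.\<close>
  define z where "z = (of_real a \<odot>\<^bsub>H\<^esub> x) \<ominus>\<^bsub>H\<^esub> (b \<odot>\<^bsub>H\<^esub> y)"
  have a: "a > 0" using False by (simp add: a_def)
  have z: "z \<in> carrier H" using x y by (simp add: z_def)
  have yx: "hinner H y x = cnj b" using hinner_cnj[OF x y] by (simp add: b_def)
  have yy: "hinner H y y = of_real a" using hinner_self[OF y] by (simp add: a_def)
  have "hinner H z z = of_real a * (of_real a * hinner H x x - b * cnj b)"
    unfolding z_def using x y
    by (simp add: hinner_diff_left hinner_diff_right hinner_scale_left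
        hinner_scale_right yy yx b_def[symmetric])
  also have "\<dots> = of_real (a * (a * (hnorm H x)\<^sup>2 - (cmod b)\<^sup>2))"
    unfolding hinner_self[OF x] complex_norm_square[symmetric] by simp
  finally have zz: "hinner H z z = of_real (a * (a * (hnorm H x)\<^sup>2 - (cmod b)\<^sup>2))" .
  have "0 \<le> a * (a * (hnorm H x)\<^sup>2 - (cmod b)\<^sup>2)"
    using hinner_nonneg[OF z] unfolding zz by (simp only: nonneg_Reals_of_real_iff)
  then have "0 \<le> a * (hnorm H x)\<^sup>2 - (cmod b)\<^sup>2"
    using a by (meson linorder_not_le mult_pos_neg)
  then have "(cmod b)\<^sup>2 \<le> (hnorm H x * hnorm H y)\<^sup>2"
    by (simp only: a_def power_mult_distrib diff_ge_0_iff_ge mult.commute)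
  then show ?thesis
    unfolding b_def
    by (rule power2_le_imp_le) (use hnorm_nonneg[OF x] hnorm_nonneg[OF y] in simp)
qed

lemma hnorm_diff_le:
  assumes x: "x \<in> carrier H" and y: "y \<in> carrier H"
  shows "hnorm H (x \<ominus>\<^bsub>H\<^esub> y) \<le> hnorm H x + hnorm H y"
proof -
  have d: "x \<ominus>\<^bsub>H\<^esub> y \<in> carrier H" using x y by simp
  have "hinner H (x \<ominus>\<^bsub>H\<^esub> y) (x \<ominus>\<^bsub>H\<^esub> y)
      = hinner H x x - hinner H x y - (hinner H y x - hinner H y y)"
    using x y by (simp add: hinner_diff_left hinner_diff_right)
  then have "complex_of_real ((hnorm H (x \<ominus>\<^bsub>H\<^esub> y))\<^sup>2)
      = of_real ((hnorm H x)\<^sup>2) - hinner H x y - (hinner H y x - of_real ((hnorm H y)\<^sup>2))"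
    by (simp only: hinner_self[OF d] hinner_self[OF x] hinner_self[OF y])
  from arg_cong[OF this, of Re]
  have "(hnorm H (x \<ominus>\<^bsub>H\<^esub> y))\<^sup>2
      = (hnorm H x)\<^sup>2 - Re (hinner H x y) - (Re (hinner H y x) - (hnorm H y)\<^sup>2)"
    by (simp only: Re_complex_of_real minus_complex.sel)
  also have "\<dots> \<le> (hnorm H x)\<^sup>2 + (hnorm H y)\<^sup>2 + 2 * (hnorm H x * hnorm H y)"
    using Cauchy_Schwarz[OF x y] Cauchy_Schwarz[OF y x, unfolded mult.commute[of "hnorm H y"]]
      abs_Re_le_cmod[of "hinner H x y"] abs_Re_le_cmod[of "hinner H y x"]
    by linarith
  also have "\<dots> = (hnorm H x + hnorm H y)\<^sup>2"
    by (simp only: power2_sum mult.assoc)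
  finally show ?thesis
    by (rule power2_le_imp_le) (use hnorm_nonneg[OF x] hnorm_nonneg[OF y] in simp)
qed

lemma hnorm_scale:
  assumes "x \<in> carrier H" shows "hnorm H (c \<odot>\<^bsub>H\<^esub> x) = cmod c * hnorm H x"
proof -
  have "hinner H (c \<odot>\<^bsub>H\<^esub> x) (c \<odot>\<^bsub>H\<^esub> x) = (c * cnj c) * hinner H x x"
    using assms by (simp add: hinner_scale_left hinner_scale_right)
  also have "\<dots> = of_real ((cmod c * hnorm H x)\<^sup>2)"
    by (simp add: hinner_self[OF assms] power_mult_distrib complex_norm_square[symmetric])
  finally have "hnorm H (c \<odot>\<^bsub>H\<^esub> x) = sqrt ((cmod c * hnorm H x)\<^sup>2)"
    unfolding hnorm_def[of H "c \<odot>\<^bsub>H\<^esub> x"] by (simp del: of_real_power)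
  then show ?thesis using hnorm_nonneg[OF assms] by simp
qed

section \<open>Bounded operators and their linear combinations\<close>

lemma bounded_opsI:
  assumes "\<And>x. x \<in> carrier H \<Longrightarrow> T x \<in> carrier H"
    and "\<And>x. x \<notin> carrier H \<Longrightarrow> T x = undefined"
    and "\<And>x y. \<lbrakk>x \<in> carrier H; y \<in> carrier H\<rbrakk> \<Longrightarrow> T (x \<oplus>\<^bsub>H\<^esub> y) = T x \<oplus>\<^bsub>H\<^esub> T y"
    and "\<And>c x. x \<in> carrier H \<Longrightarrow> T (c \<odot>\<^bsub>H\<^esub> x) = c \<odot>\<^bsub>H\<^esub> T x"
    and "\<And>x. x \<in> carrier H \<Longrightarrow> hnorm H (T x) \<le> C * hnorm H x"
  shows "T \<in> bounded_ops H"
proof -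
  have "\<exists>C. \<forall>x\<in>carrier H. hnorm H (T x) \<le> C * hnorm H x"
    using assms(5) by blast
  then show ?thesis
    using assms(1-4) unfolding bounded_ops_def by (simp add: PiE_def extensional_def)
qed

lemma bounded_op_closed: "\<lbrakk>T \<in> bounded_ops H; x \<in> carrier H\<rbrakk> \<Longrightarrow> T x \<in> carrier H"
  and bounded_op_undefined: "\<lbrakk>T \<in> bounded_ops H; x \<notin> carrier H\<rbrakk> \<Longrightarrow> T x = undefined"
  and bounded_op_add: "\<lbrakk>T \<in> bounded_ops H; x \<in> carrier H; y \<in> carrier H\<rbrakk>
    \<Longrightarrow> T (x \<oplus>\<^bsub>H\<^esub> y) = T x \<oplus>\<^bsub>H\<^esub> T y"
  and bounded_op_scale: "\<lbrakk>T \<in> bounded_ops H; x \<in> carrier H\<rbrakk> \<Longrightarrow> T (c \<odot>\<^bsub>H\<^esub> x) = c \<odot>\<^bsub>H\<^esub> T x"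
  unfolding bounded_ops_def by (auto simp: PiE_def extensional_def)

text \<open>Passing to \<open>max C 0\<close> makes the constant nonnegative, which allows bounds to
  be multiplied when operators are composed.\<close>

lemma bounded_op_bound:
  assumes "T \<in> bounded_ops H"
  obtains C where "C \<ge> 0" "\<And>x. x \<in> carrier H \<Longrightarrow> hnorm H (T x) \<le> C * hnorm H x"
proof -
  obtain C where C: "\<And>x. x \<in> carrier H \<Longrightarrow> hnorm H (T x) \<le> C * hnorm H x"
    using assms unfolding bounded_ops_def mem_Collect_eq by metis
  show ?thesis
  proof (rule that[of "max C 0"])
    fix x assume "x \<in> carrier H"
    then show "hnorm H (T x) \<le> max C 0 * hnorm H x"
      using C[of x] hnorm_nonneg[of x] by (smt (verit) mult_right_mono)
  qed simp
qed

text \<open>Operators are extensional, so matrix coefficients on the carrier determine them: off the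
  carrier both sides are \<open>undefined\<close>.\<close>

lemma operator_eqI:
  assumes "S \<in> bounded_ops H" "T \<in> bounded_ops H"
    and "\<And>x y. \<lbrakk>x \<in> carrier H; y \<in> carrier H\<rbrakk> \<Longrightarrow> hinner H (S x) y = hinner H (T x) y"
  shows "S = T"
proof
  fix x show "S x = T x"
    using assms by (cases "x \<in> carrier H")
      (auto intro!: vector_eqI simp: bounded_op_closed bounded_op_undefined)
qed

lemma op_id_bounded: "op_id H \<in> bounded_ops H"
  by (rule bounded_opsI[where C = 1]) (auto simp: op_id_def)

lemma op_zero_bounded: "op_zero H \<in> bounded_ops H"
proof (rule bounded_opsI[where C = 0])
  show "hnorm H (op_zero H x) \<le> 0 * hnorm H x" if "x \<in> carrier H" for x
    using that by (simp add: op_zero_def hnorm_def)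
qed (auto simp: op_zero_def smult_r_null)

lemma compose_bounded:
  assumes "S \<in> bounded_ops H" "T \<in> bounded_ops H"
  shows "compose (carrier H) S T \<in> bounded_ops H"
proof -
  obtain C where C: "C \<ge> 0" "\<And>x. x \<in> carrier H \<Longrightarrow> hnorm H (S x) \<le> C * hnorm H x"
    using bounded_op_bound[OF assms(1)] by blast
  obtain D where D: "D \<ge> 0" "\<And>x. x \<in> carrier H \<Longrightarrow> hnorm H (T x) \<le> D * hnorm H x"
    using bounded_op_bound[OF assms(2)] by blast
  show ?thesis
  proof (rule bounded_opsI[where C = "C * D"])
    fix x assume x: "x \<in> carrier H"
    have "hnorm H (S (T x)) \<le> C * (D * hnorm H x)"
      using C(2)[OF bounded_op_closed[OF assms(2) x]] mult_left_mono[OF D(2)[OF x] C(1)] by simp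
    then show "hnorm H (compose (carrier H) S T x) \<le> C * D * hnorm H x"
      using x by (simp add: compose_def mult.assoc)
  qed (use assms in \<open>auto simp: compose_def bounded_op_closed bounded_op_add bounded_op_scale\<close>)
qed

lemma op_scale_bounded:
  assumes "T \<in> bounded_ops H" shows "op_scale H c T \<in> bounded_ops H"
proof -
  obtain C where C: "C \<ge> 0" "\<And>x. x \<in> carrier H \<Longrightarrow> hnorm H (T x) \<le> C * hnorm H x"
    using bounded_op_bound[OF assms] by blast
  show ?thesis
  proof (rule bounded_opsI[where C = "cmod c * C"])
    fix x assume x: "x \<in> carrier H"
    show "hnorm H (op_scale H c T x) \<le> cmod c * C * hnorm H x"
      using C(2)[OF x] x bounded_op_closed[OF assms x]
      by (simp add: op_scale_def hnorm_scale mult_left_mono mult.assoc)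
    show "op_scale H c T (b \<odot>\<^bsub>H\<^esub> x) = b \<odot>\<^bsub>H\<^esub> op_scale H c T x" for b
      using x bounded_op_closed[OF assms x] smult_assoc1[of c b "T x"] smult_assoc1[of b c "T x"]
      by (simp add: op_scale_def bounded_op_scale[OF assms] mult.commute)
  qed (use assms in \<open>auto simp: op_scale_def bounded_op_closed bounded_op_add smult_r_distr\<close>)
qed

lemma hinner_op_scale:
  assumes "T \<in> bounded_ops H" "x \<in> carrier H" "y \<in> carrier H"
  shows "hinner H (op_scale H c T x) y = c * hinner H (T x) y"
  using assms by (simp add: op_scale_def hinner_scale_left bounded_op_closed)

lemma hinner_op_diff:
  assumes "S \<in> bounded_ops H" "T \<in> bounded_ops H" "x \<in> carrier H" "y \<in> carrier H"
  shows "hinner H (op_diff H S T x) y = hinner H (S x) y - hinner H (T x) y"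
  using assms by (simp add: op_diff_def hinner_diff_left bounded_op_closed)

lemma op_diff_bounded:
  assumes "S \<in> bounded_ops H" "T \<in> bounded_ops H"
  shows "op_diff H S T \<in> bounded_ops H"
proof -
  obtain C where C: "C \<ge> 0" "\<And>x. x \<in> carrier H \<Longrightarrow> hnorm H (S x) \<le> C * hnorm H x"
    using bounded_op_bound[OF assms(1)] by blast
  obtain D where D: "D \<ge> 0" "\<And>x. x \<in> carrier H \<Longrightarrow> hnorm H (T x) \<le> D * hnorm H x"
    using bounded_op_bound[OF assms(2)] by blast
  note cl = bounded_op_closed[OF assms(1)] bounded_op_closed[OF assms(2)]
  show ?thesis
  proof (rule bounded_opsI[where C = "C + D"])
    fix x assume x: "x \<in> carrier H"
    show "hnorm H (op_diff H S T x) \<le> (C + D) * hnorm H x"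
      using C(2)[OF x] D(2)[OF x] hnorm_diff_le[OF cl(1)[OF x] cl(2)[OF x]] x
      by (simp add: op_diff_def algebra_simps)
    show "op_diff H S T (b \<odot>\<^bsub>H\<^esub> x) = b \<odot>\<^bsub>H\<^esub> op_diff H S T x" for b
      using x cl by (intro vector_eqI)
        (auto simp: op_diff_def hinner_diff_left hinner_scale_left bounded_op_scale assms algebra_simps)
    fix y assume y: "y \<in> carrier H"
    show "op_diff H S T (x \<oplus>\<^bsub>H\<^esub> y) = op_diff H S T x \<oplus>\<^bsub>H\<^esub> op_diff H S T y"
      using x y cl by (intro vector_eqI)
        (auto simp: op_diff_def hinner_diff_left hinner_add_left bounded_op_add assms)
  qed (use cl in \<open>auto simp: op_diff_def\<close>)
qed

text \<open>Finite operator sums are handled through their sesquilinear forms. A bounded operator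
  with the prescribed form exists by induction, and \<open>operator_eqI\<close> makes it
  unique.\<close>

lemma linear_combination_exists:
  assumes "finite A" and "\<And>a. a \<in> A \<Longrightarrow> T a \<in> bounded_ops H"
  shows "\<exists>Z\<in>bounded_ops H. \<forall>x\<in>carrier H. \<forall>y\<in>carrier H.
           hinner H (Z x) y = (\<Sum>a\<in>A. c a * hinner H (T a x) y)"
  using assms
proof (induction A)
  case empty
  show ?case using op_zero_bounded by (intro bexI[of _ "op_zero H"]) (auto simp: op_zero_def)
next
  case (insert a A)
  then obtain Z where Z: "Z \<in> bounded_ops H"
    "\<forall>x\<in>carrier H. \<forall>y\<in>carrier H. hinner H (Z x) y = (\<Sum>a\<in>A. c a * hinner H (T a x) y)"
    by auto
  have T: "T a \<in> bounded_ops H" using insert.prems by auto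
  show ?case
    using insert Z T
    by (intro bexI[of _ "op_diff H Z (op_scale H (- c a) (T a))"])
      (auto simp: hinner_op_diff hinner_op_scale op_scale_bounded op_diff_bounded)
qed

section \<open>Words in an operator tuple and nilpotency\<close>

lemma op_word_Nil [simp]: "op_word H X [] = op_id H"
  by (simp add: op_word_def)

lemma op_word_Cons: "op_word H X (i # \<alpha>) = compose (carrier H) (X i) (op_word H X \<alpha>)"
  by (simp add: op_word_def)

lemma op_word_bounded:
  assumes "range X \<subseteq> bounded_ops H" shows "op_word H X \<alpha> \<in> bounded_ops H"
  by (induction \<alpha>) (auto simp: op_word_Cons op_id_bounded range_subsetD[OF assms] compose_bounded)

lemma op_word_append:
  assumes "range X \<subseteq> bounded_ops H" "x \<in> carrier H"
  shows "op_word H X (\<alpha> @ \<beta>) x = op_word H X \<alpha> (op_word H X \<beta> x)"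
proof -
  have "op_word H X \<beta> x \<in> carrier H"
    using assms by (intro bounded_op_closed[OF op_word_bounded]) auto
  then show ?thesis
    using assms(2) by (induction \<alpha>) (simp_all add: op_word_Cons compose_def op_id_def)
qed

lemma op_word_single:
  assumes "range X \<subseteq> bounded_ops H" shows "op_word H X [i] = X i"
proof
  fix x show "op_word H X [i] x = X i x"
    using bounded_op_undefined[OF range_subsetD[OF assms]] by (simp add: op_word_Cons compose_def op_id_def)
qed

lemma op_word_scale:
  assumes "range X \<subseteq> bounded_ops H"
  shows "op_word H (\<lambda>i. op_scale H c (X i)) \<alpha> = op_scale H (c ^ length \<alpha>) (op_word H X \<alpha>)"
proof (induction \<alpha>)
  case Nil
  show ?case using smult_one by (auto simp: fun_eq_iff op_id_def op_scale_def)
next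
  case (Cons i \<alpha>)
  show ?case
  proof
    fix x
    show "op_word H (\<lambda>i. op_scale H c (X i)) (i # \<alpha>) x
      = op_scale H (c ^ length (i # \<alpha>)) (op_word H X (i # \<alpha>)) x"
    proof (cases "x \<in> carrier H")
      case True
      have w: "op_word H X \<alpha> x \<in> carrier H"
        by (rule bounded_op_closed[OF op_word_bounded[OF assms] True])
      then have Xw: "X i (op_word H X \<alpha> x) \<in> carrier H"
        by (rule bounded_op_closed[OF range_subsetD[OF assms]])
      have "op_word H (\<lambda>i. op_scale H c (X i)) \<alpha> x = (c ^ length \<alpha>) \<odot>\<^bsub>H\<^esub> op_word H X \<alpha> x"
        unfolding Cons using True by (simp add: op_scale_def)
      then have "op_word H (\<lambda>i. op_scale H c (X i)) (i # \<alpha>) x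
        = c \<odot>\<^bsub>H\<^esub> ((c ^ length \<alpha>) \<odot>\<^bsub>H\<^esub> X i (op_word H X \<alpha> x))"
        using True w by (simp add: op_word_Cons compose_def op_scale_def
            bounded_op_scale[OF range_subsetD[OF assms]])
      also have "\<dots> = (c * c ^ length \<alpha>) \<odot>\<^bsub>H\<^esub> X i (op_word H X \<alpha> x)"
        using smult_assoc1[of c "c ^ length \<alpha>", OF _ _ Xw] by simp
      finally show ?thesis using True by (simp add: op_word_Cons compose_def op_scale_def)
    qed (simp add: op_word_Cons compose_def op_scale_def)
  qed
qed

text \<open>Unlike \<^const>\<open>nilpotent_tuple\<close>, this also covers the words longer than \<open>p\<close>.\<close>

definition nilpotent_order :: "nat \<Rightarrow> ('n \<Rightarrow> 'h \<Rightarrow> 'h) \<Rightarrow> bool" where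
  "nilpotent_order p N \<longleftrightarrow> p \<ge> 1 \<and> (\<forall>\<alpha>. p \<le> length \<alpha> \<longrightarrow> op_word H N \<alpha> = op_zero H)"

text \<open>A word of length at least p factors through its prefix of length p, which is already
  zero.\<close>

lemma nilpotent_tuple_order:
  assumes "range N \<subseteq> bounded_ops H" "nilpotent_tuple H N"
  obtains p where "nilpotent_order p N"
proof -
  obtain p where p: "p \<ge> 1" "\<And>\<alpha>. length \<alpha> = p \<Longrightarrow> op_word H N \<alpha> = op_zero H"
    using assms(2) unfolding nilpotent_tuple_def by auto
  have "op_word H N \<alpha> = op_zero H" if "p \<le> length \<alpha>" for \<alpha>
  proof (rule operator_eqI)
    fix x y assume xy: "x \<in> carrier H" "y \<in> carrier H"
    have "op_word H N \<alpha> x = op_word H N (take p \<alpha>) (op_word H N (drop p \<alpha>) x)"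
      using op_word_append[where \<alpha> = "take p \<alpha>" and \<beta> = "drop p \<alpha>", OF assms(1) xy(1)]
      by simp
    also have "\<dots> = \<zero>\<^bsub>H\<^esub>"
      using that p(2)[of "take p \<alpha>"] bounded_op_closed[OF op_word_bounded[OF assms(1)] xy(1)]
      by (simp add: op_zero_def)
    finally show "hinner H (op_word H N \<alpha> x) y = hinner H (op_zero H x) y"
      using xy by (simp add: op_zero_def)
  qed (auto simp: op_word_bounded assms op_zero_bounded)
  then show ?thesis using that p(1) by (auto simp: nilpotent_order_def)
qed

lemma nilpotent_orderD: "nilpotent_order p N \<Longrightarrow> nilpotent_tuple H N"
  unfolding nilpotent_order_def nilpotent_tuple_def by auto

lemma nilpotent_order_scale:
  assumes "range N \<subseteq> bounded_ops H" "nilpotent_order p N"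
  shows "nilpotent_order p (\<lambda>i. op_scale H c (N i))"
  using assms(2) unfolding nilpotent_order_def op_word_scale[OF assms(1)]
  by (auto simp: op_scale_def op_zero_def smult_r_null)

end

section \<open>Evaluation at nilpotent tuples\<close>

lemma finite_words [simp, intro]:
  "finite {\<alpha> :: 'n::finite list. length \<alpha> < p}"
  "finite {\<alpha> :: 'n::finite list. length \<alpha> \<le> p}"
  "finite {\<alpha> :: 'n::finite list. length \<alpha> = p}"
proof -
  show le: "finite {\<alpha> :: 'n list. length \<alpha> \<le> p}"
    using finite_lists_length_le[of "UNIV :: 'n set" p] by simp
  show "finite {\<alpha> :: 'n list. length \<alpha> < p}" "finite {\<alpha> :: 'n list. length \<alpha> = p}"
    by (rule finite_subset[OF _ le]; auto)+
qed

text \<open>Concatenation identifies pairs of words with single words carrying a cut position, and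
  the sum over the cuts is the convolution. The hypothesis on w, which will be a functional of a
  nilpotent word, discards all pairs of total length at least p.\<close>

lemma sum_ncps_mult:
  fixes q s w :: "'n::finite list \<Rightarrow> complex"
  assumes "\<And>\<beta>. p \<le> length \<beta> \<Longrightarrow> w \<beta> = 0"
  shows "(\<Sum>\<gamma> | length \<gamma> < p. \<Sum>\<delta> | length \<delta> < p. q \<gamma> * (s \<delta> * w (\<gamma> @ \<delta>)))
    = (\<Sum>\<beta> | length \<beta> < p. ncps_mult q s \<beta> * w \<beta>)"
proof -
  let ?W = "{\<beta> :: 'n list. length \<beta> < p}"
  have "(\<Sum>\<gamma>\<in>?W. \<Sum>\<delta>\<in>?W. q \<gamma> * (s \<delta> * w (\<gamma> @ \<delta>)))
      = (\<Sum>(\<gamma>, \<delta>)\<in>?W \<times> ?W. q \<gamma> * (s \<delta> * w (\<gamma> @ \<delta>)))"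
    by (simp add: sum.cartesian_product)
  also have "\<dots> = (\<Sum>(\<gamma>, \<delta>)\<in>{(\<gamma>, \<delta>). length \<gamma> + length \<delta> < p}. q \<gamma> * (s \<delta> * w (\<gamma> @ \<delta>)))"
  proof (rule sum.mono_neutral_right)
    have "length \<gamma> + length \<delta> < p" if "w (\<gamma> @ \<delta>) \<noteq> 0" for \<gamma> \<delta>
      using assms[of "\<gamma> @ \<delta>"] that by (cases "p \<le> length \<gamma> + length \<delta>") auto
    then show "\<forall>z\<in>?W \<times> ?W - {(\<gamma>, \<delta>). length \<gamma> + length \<delta> < p}.
        (case z of (\<gamma>, \<delta>) \<Rightarrow> q \<gamma> * (s \<delta> * w (\<gamma> @ \<delta>))) = 0" by auto
  qed auto
  also have "\<dots> = (\<Sum>(\<beta>, k)\<in>(SIGMA \<beta>:?W. {..length \<beta>}). q (take k \<beta>) * (s (drop k \<beta>) * w \<beta>))"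
    by (rule sum.reindex_bij_witness[of _ "\<lambda>(\<beta>, k). (take k \<beta>, drop k \<beta>)"
          "\<lambda>(\<gamma>, \<delta>). (\<gamma> @ \<delta>, length \<gamma>)"]) auto
  also have "\<dots> = (\<Sum>\<beta>\<in>?W. \<Sum>k\<le>length \<beta>. q (take k \<beta>) * (s (drop k \<beta>) * w \<beta>))"
    by (rule sum.Sigma[symmetric]) auto
  also have "\<dots> = (\<Sum>\<beta>\<in>?W. ncps_mult q s \<beta> * w \<beta>)"
    by (simp add: ncps_mult_def sum_distrib_right mult.assoc)
  finally show ?thesis .
qed

context complex_hilbert_space
begin

text \<open>Algebraic linearity is enough because evaluations at nilpotent tuples are finite sums.
  Unlike pairings with a fixed vector, this class is closed under composition with bounded operators
  without any appeal to adjoints, as the induction in \<open>op_word_ncps_eval\<close>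
  requires.\<close>

definition linear_functional :: "('h \<Rightarrow> complex) \<Rightarrow> bool" where
  "linear_functional \<phi> \<longleftrightarrow>
     (\<forall>x\<in>carrier H. \<forall>y\<in>carrier H. \<phi> (x \<oplus>\<^bsub>H\<^esub> y) = \<phi> x + \<phi> y) \<and>
     (\<forall>c. \<forall>x\<in>carrier H. \<phi> (c \<odot>\<^bsub>H\<^esub> x) = c * \<phi> x)"

lemma linear_functional_zero:
  assumes "linear_functional \<phi>" shows "\<phi> \<zero>\<^bsub>H\<^esub> = 0"
proof -
  have "\<phi> (\<zero>\<^bsub>H\<^esub> \<oplus>\<^bsub>H\<^esub> \<zero>\<^bsub>H\<^esub>) = \<phi> \<zero>\<^bsub>H\<^esub> + \<phi> \<zero>\<^bsub>H\<^esub>"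
    using assms unfolding linear_functional_def by blast
  then show ?thesis by simp
qed

lemma linear_functional_finsum:
  assumes "linear_functional \<phi>" "finite A" "\<And>a. a \<in> A \<Longrightarrow> v a \<in> carrier H"
  shows "\<phi> (\<Oplus>\<^bsub>H\<^esub>a\<in>A. v a) = (\<Sum>a\<in>A. \<phi> (v a))"
  using assms(2,3)
proof (induction A)
  case empty
  show ?case by (simp add: linear_functional_zero[OF assms(1)])
next
  case (insert a A)
  then have v: "v \<in> A \<rightarrow> carrier H" "v a \<in> carrier H" by auto
  have "\<phi> (\<Oplus>\<^bsub>H\<^esub>a\<in>insert a A. v a) = \<phi> (v a \<oplus>\<^bsub>H\<^esub> (\<Oplus>\<^bsub>H\<^esub>a\<in>A. v a))"
    using insert v by (simp add: M.finsum_insert)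
  also have "\<dots> = \<phi> (v a) + \<phi> (\<Oplus>\<^bsub>H\<^esub>a\<in>A. v a)"
    using assms(1) v M.finsum_closed[OF v(1)] unfolding linear_functional_def by blast
  finally show ?case using insert by simp
qed

lemma linear_functional_hinner: "y \<in> carrier H \<Longrightarrow> linear_functional (\<lambda>x. hinner H x y)"
  by (auto simp: linear_functional_def hinner_add_left hinner_scale_left)

lemma linear_functional_comp:
  assumes "linear_functional \<phi>" "T \<in> bounded_ops H" shows "linear_functional (\<lambda>x. \<phi> (T x))"
  using assms(1) bounded_op_closed[OF assms(2)]
  by (auto simp: linear_functional_def bounded_op_add[OF assms(2)] bounded_op_scale[OF assms(2)])

section \<open>Evaluation as a finite sum, and its compatibility with composition\<close>

lemma op_word_closed:
  assumes "range X \<subseteq> bounded_ops H" "x \<in> carrier H"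
  shows "op_word H X \<alpha> x \<in> carrier H"
  by (rule bounded_op_closed[OF op_word_bounded]) (use assms in auto)

lemma nilpotent_order_apply:
  assumes "nilpotent_order p N" "p \<le> length \<alpha>" "x \<in> carrier H"
  shows "op_word H N \<alpha> x = \<zero>\<^bsub>H\<^esub>"
  using assms by (auto simp: nilpotent_order_def op_zero_def)

lemma nonzero_words:
  assumes "nilpotent_order p N"
  shows "{\<alpha>. op_word H N \<alpha> \<noteq> op_zero H} \<subseteq> {\<alpha>. length \<alpha> < p}"
  using assms by (auto simp: nilpotent_order_def not_le[symmetric])

lemma ncps_eval_closed:
  assumes "range N \<subseteq> bounded_ops H" "x \<in> carrier H"
  shows "ncps_eval H F N i x \<in> carrier H"
  using assms by (auto simp: ncps_eval_def intro!: M.finsum_closed op_word_closed)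

text \<open>Vanishing words contribute nothing, so the index set depending on N can be enlarged to
  all words shorter than p. Operator identities thereby become identities between finite sums of
  complex numbers.\<close>

lemma ncps_eval_functional:
  assumes N: "range N \<subseteq> bounded_ops H" "nilpotent_order p N"
    and \<phi>: "linear_functional \<phi>" and x: "x \<in> carrier H"
  shows "\<phi> (ncps_eval H F N i x) = (\<Sum>\<alpha> | length \<alpha> < p. F i \<alpha> * \<phi> (op_word H N \<alpha> x))"
proof -
  let ?A = "{\<alpha>. op_word H N \<alpha> \<noteq> op_zero H}"
  have fin: "finite ?A" by (rule finite_subset[OF nonzero_words[OF N(2)]]) simp
  have "\<phi> (ncps_eval H F N i x) = (\<Sum>\<alpha>\<in>?A. \<phi> (F i \<alpha> \<odot>\<^bsub>H\<^esub> op_word H N \<alpha> x))"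
    unfolding ncps_eval_def
    using x by (simp add: linear_functional_finsum[OF \<phi> fin] op_word_closed[OF N(1)])
  also have "\<dots> = (\<Sum>\<alpha>\<in>?A. F i \<alpha> * \<phi> (op_word H N \<alpha> x))"
    using \<phi> x op_word_closed[OF N(1) x] by (simp add: linear_functional_def)
  also have "\<dots> = (\<Sum>\<alpha> | length \<alpha> < p. F i \<alpha> * \<phi> (op_word H N \<alpha> x))"
    by (rule sum.mono_neutral_left[OF _ nonzero_words[OF N(2)]])
      (auto simp: x op_zero_def linear_functional_zero[OF \<phi>])
  finally show ?thesis .
qed

lemma op_word_ncps_eval:
  assumes N: "range N \<subseteq> bounded_ops H" "nilpotent_order p N"
    and X: "range (ncps_eval H P N) \<subseteq> bounded_ops H"
    and \<phi>: "linear_functional \<phi>" and x: "x \<in> carrier H"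
  shows "\<phi> (op_word H (ncps_eval H P N) \<alpha> x)
    = (\<Sum>\<beta> | length \<beta> < p. ncps_word P \<alpha> \<beta> * \<phi> (op_word H N \<beta> x))"
  using \<phi>
proof (induction \<alpha> arbitrary: \<phi>)
  case Nil
  have "(\<Sum>\<beta> | length \<beta> < p. ncps_word P [] \<beta> * \<phi> (op_word H N \<beta> x))
      = (\<Sum>\<beta>\<in>{[]}. ncps_word P [] \<beta> * \<phi> (op_word H N \<beta> x))"
    using N(2) by (intro sum.mono_neutral_right)
      (auto simp: ncps_word_def ncps_one_def nilpotent_order_def)
  then show ?case using x by (simp add: ncps_word_def ncps_one_def)
next
  case (Cons i \<alpha>)
  let ?X = "ncps_eval H P N"
  let ?W = "{\<beta> :: 'a list. length \<beta> < p}"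
  define y where "y = op_word H ?X \<alpha> x"
  have y: "y \<in> carrier H" unfolding y_def by (rule op_word_closed[OF X x])
  have "\<phi> (op_word H ?X (i # \<alpha>) x) = \<phi> (ncps_eval H P N i y)"
    using x by (simp add: op_word_Cons compose_def y_def)
  also have "\<dots> = (\<Sum>\<gamma>\<in>?W. P i \<gamma> * \<phi> (op_word H N \<gamma> y))"
    by (rule ncps_eval_functional[OF N Cons.prems y])
  also have "\<dots> = (\<Sum>\<gamma>\<in>?W. P i \<gamma> * (\<Sum>\<delta>\<in>?W. ncps_word P \<alpha> \<delta> * \<phi> (op_word H N \<gamma> (op_word H N \<delta> x))))"
    \<comment> \<open>The induction hypothesis is applied to \<phi> composed with the word \<gamma>;
      this is why \<phi> is arbitrary in the induction.\<close>
    unfolding y_def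
    by (simp only: Cons.IH[OF linear_functional_comp[OF Cons.prems op_word_bounded[OF N(1)]]])
  also have "\<dots> = (\<Sum>\<gamma>\<in>?W. \<Sum>\<delta>\<in>?W. P i \<gamma> * (ncps_word P \<alpha> \<delta> * \<phi> (op_word H N (\<gamma> @ \<delta>) x)))"
    by (simp add: sum_distrib_left op_word_append[OF N(1) x])
  also have "\<dots> = (\<Sum>\<beta>\<in>?W. ncps_mult (P i) (ncps_word P \<alpha>) \<beta> * \<phi> (op_word H N \<beta> x))"
    by (rule sum_ncps_mult)
      (simp add: nilpotent_order_apply[OF N(2) _ x] linear_functional_zero[OF Cons.prems])
  finally show ?case by (simp add: ncps_word_def)
qed

text \<open>Without constant terms, the formal word P_\<alpha> has no coefficients at words shorter
  than \<alpha>, while N kills all words of length at least p. For |\<alpha>| \<ge> p nothing is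
  left.\<close>

lemma nilpotent_order_ncps_eval:
  assumes N: "range N \<subseteq> bounded_ops H" "nilpotent_order p N"
    and X: "range (ncps_eval H P N) \<subseteq> bounded_ops H" and P: "\<And>i. P i [] = 0"
  shows "nilpotent_order p (ncps_eval H P N)"
  unfolding nilpotent_order_def
proof (intro conjI allI impI)
  show "1 \<le> p" using N(2) by (simp add: nilpotent_order_def)
  fix \<alpha> :: "'a list" assume \<alpha>: "p \<le> length \<alpha>"
  show "op_word H (ncps_eval H P N) \<alpha> = op_zero H"
  proof (rule operator_eqI)
    fix x y assume xy: "x \<in> carrier H" "y \<in> carrier H"
    have "hinner H (op_word H (ncps_eval H P N) \<alpha> x) y
      = (\<Sum>\<beta> | length \<beta> < p. ncps_word P \<alpha> \<beta> * hinner H (op_word H N \<beta> x) y)"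
      by (rule op_word_ncps_eval[OF N X linear_functional_hinner[OF xy(2)] xy(1)])
    also have "\<dots> = 0"
      using \<alpha> by (intro sum.neutral) (auto simp: ncps_word_eq_0[of P, OF P])
    finally show "hinner H (op_word H (ncps_eval H P N) \<alpha> x) y = hinner H (op_zero H x) y"
      using xy by (simp add: op_zero_def)
  qed (auto simp: op_word_bounded X op_zero_bounded)
qed

text \<open>Both sides are one finite double sum taken in different orders. For |\<beta>| < p the
  sum over all \<alpha> with |\<alpha>| < p agrees with the sum over |\<alpha>| \<le> |\<beta>| in
  \<open>ncps_compose\<close>, because the other coefficients vanish when P(0) = 0.\<close>

lemma ncps_eval_compose:
  assumes N: "range N \<subseteq> bounded_ops H" "nilpotent_tuple H N"
    and X: "range (ncps_eval H P N) \<subseteq> bounded_ops H" and P: "\<And>i. P i [] = 0"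
  shows "ncps_eval H F (ncps_eval H P N) = ncps_eval H (ncps_compose F P) N"
proof (intro ext)
  fix i x
  obtain p where p: "nilpotent_order p N" using nilpotent_tuple_order[OF N] .
  let ?X = "ncps_eval H P N"
  let ?W = "{\<beta> :: 'a list. length \<beta> < p}"
  show "ncps_eval H F ?X i x = ncps_eval H (ncps_compose F P) N i x"
  proof (cases "x \<in> carrier H")
    case x: True
    show ?thesis
    proof (rule vector_eqI)
      fix y assume y: "y \<in> carrier H"
      note lf = linear_functional_hinner[OF y]
      have "hinner H (ncps_eval H F ?X i x) y = (\<Sum>\<alpha>\<in>?W. F i \<alpha> * hinner H (op_word H ?X \<alpha> x) y)"
        by (rule ncps_eval_functional[OF X nilpotent_order_ncps_eval[OF N(1) p X P] lf x])
      also have "\<dots> = (\<Sum>\<alpha>\<in>?W. \<Sum>\<beta>\<in>?W. F i \<alpha> * ncps_word P \<alpha> \<beta> * hinner H (op_word H N \<beta> x) y)"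
        by (simp add: op_word_ncps_eval[OF N(1) p X lf x] sum_distrib_left mult.assoc)
      also have "\<dots> = (\<Sum>\<beta>\<in>?W. (\<Sum>\<alpha>\<in>?W. F i \<alpha> * ncps_word P \<alpha> \<beta>) * hinner H (op_word H N \<beta> x) y)"
        by (subst sum.swap) (simp add: sum_distrib_right)
      also have "\<dots> = (\<Sum>\<beta>\<in>?W. ncps_compose F P i \<beta> * hinner H (op_word H N \<beta> x) y)"
      proof (rule sum.cong[OF refl], rule arg_cong2[of _ _ _ _ "(*)", OF _ refl])
        fix \<beta> assume "\<beta> \<in> ?W"
        then show "(\<Sum>\<alpha>\<in>?W. F i \<alpha> * ncps_word P \<alpha> \<beta>) = ncps_compose F P i \<beta>"
          unfolding ncps_compose_def
          by (intro sum.mono_neutral_right) (auto simp: ncps_word_eq_0[of P, OF P] not_le)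
      qed
      also have "\<dots> = hinner H (ncps_eval H (ncps_compose F P) N i x) y"
        by (rule ncps_eval_functional[OF N(1) p lf x, symmetric])
      finally show "hinner H (ncps_eval H F ?X i x) y
        = hinner H (ncps_eval H (ncps_compose F P) N i x) y" .
    qed (auto simp: ncps_eval_closed X N x)
  qed (simp add: ncps_eval_def)
qed

lemma ncps_eval_var:
  assumes N: "range N \<subseteq> bounded_ops H" "nilpotent_tuple H N"
  shows "ncps_eval H ncps_var N = N"
proof (intro ext)
  fix i x
  obtain p where p: "nilpotent_order p N" using nilpotent_tuple_order[OF N] .
  show "ncps_eval H ncps_var N i x = N i x"
  proof (cases "x \<in> carrier H")
    case x: True
    show ?thesis
    proof (rule vector_eqI)
      fix y assume y: "y \<in> carrier H"
      have "hinner H (ncps_eval H ncps_var N i x) y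
        = (\<Sum>\<alpha> | length \<alpha> < p. ncps_var i \<alpha> * hinner H (op_word H N \<alpha> x) y)"
        by (rule ncps_eval_functional[OF N(1) p linear_functional_hinner[OF y] x])
      also have "\<dots> = (\<Sum>\<alpha> | length \<alpha> < p. if \<alpha> = [i] then hinner H (op_word H N [i] x) y else 0)"
        by (rule sum.cong) (auto simp: ncps_var_def)
      \<comment> \<open>For p = 1 the word \<open>[i]\<close> is outside the range of summation, but
        then it evaluates to zero as well.\<close>
      also have "\<dots> = hinner H (op_word H N [i] x) y"
        using nilpotent_order_apply[OF p, of "[i]", OF _ x] y by (simp add: sum.delta)
      also have "op_word H N [i] = N i" by (rule op_word_single[OF N(1)])
      finally show "hinner H (ncps_eval H ncps_var N i x) y = hinner H (N i x) y" .
    qed (auto simp: ncps_eval_closed N x bounded_op_closed[OF range_subsetD[OF N(1)]])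
  qed (simp add: ncps_eval_def bounded_op_undefined[OF range_subsetD[OF N(1)]])
qed

lemma ncps_eval_scale:
  assumes N: "range N \<subseteq> bounded_ops H" "nilpotent_tuple H N"
  shows "ncps_eval H (\<lambda>i \<alpha>. c * F i \<alpha>) N = (\<lambda>i. op_scale H c (ncps_eval H F N i))"
proof (intro ext)
  fix i x
  obtain p where p: "nilpotent_order p N" using nilpotent_tuple_order[OF N] .
  show "ncps_eval H (\<lambda>i \<alpha>. c * F i \<alpha>) N i x = op_scale H c (ncps_eval H F N i) x"
  proof (cases "x \<in> carrier H")
    case x: True
    show ?thesis
    proof (rule vector_eqI)
      fix y assume y: "y \<in> carrier H"
      note eval = ncps_eval_functional[OF N(1) p linear_functional_hinner[OF y] x]
      show "hinner H (ncps_eval H (\<lambda>i \<alpha>. c * F i \<alpha>) N i x) y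
        = hinner H (op_scale H c (ncps_eval H F N i) x) y"
        using x y by (simp add: op_scale_def hinner_scale_left ncps_eval_closed[OF N(1)] eval
            sum_distrib_left mult.assoc)
    qed (auto simp: ncps_eval_closed N x op_scale_def)
  qed (simp add: ncps_eval_def op_scale_def)
qed

end

section \<open>Nilpotent parts of noncommutative domains\<close>

text \<open>The existence of adjoints is an assumption here, in place of a Riesz representation
  argument. It is verified below for the spaces \<complex>^d, the only ones at which the proof of
  linearity evaluates F.\<close>

locale hilbert_with_adjoints = complex_hilbert_space +
  assumes adjoint_exists:
    "T \<in> bounded_ops H \<Longrightarrow>
      \<exists>S\<in>bounded_ops H. \<forall>x\<in>carrier H. \<forall>y\<in>carrier H. hinner H (T x) y = hinner H x (S y)"
begin

section \<open>Adjoints\<close>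

lemma op_adjoint_eqI:
  assumes "S \<in> bounded_ops H"
    and S: "\<And>x y. \<lbrakk>x \<in> carrier H; y \<in> carrier H\<rbrakk> \<Longrightarrow> hinner H (T x) y = hinner H x (S y)"
  shows "op_adjoint H T = S"
  unfolding op_adjoint_def
proof (rule the_equality)
  fix S' assume S': "S' \<in> bounded_ops H \<and>
    (\<forall>x\<in>carrier H. \<forall>y\<in>carrier H. hinner H (T x) y = hinner H x (S' y))"
  show "S' = S"
  proof (rule operator_eqI)
    fix x y assume xy: "x \<in> carrier H" "y \<in> carrier H"
    have "hinner H y (S' x) = hinner H y (S x)" using S' S xy by metis
    then show "hinner H (S' x) y = hinner H (S x) y"
      using hinner_cnj[OF xy(2) bounded_op_closed[OF assms(1) xy(1)]] S'
        hinner_cnj[OF xy(2) bounded_op_closed[OF _ xy(1), of S']] by simp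
  qed (use assms S' in auto)
qed (use assms in auto)

lemma op_adjoint:
  assumes "T \<in> bounded_ops H"
  shows op_adjoint_bounded: "op_adjoint H T \<in> bounded_ops H"
    and hinner_op_adjoint: "\<lbrakk>x \<in> carrier H; y \<in> carrier H\<rbrakk>
      \<Longrightarrow> hinner H (T x) y = hinner H x (op_adjoint H T y)"
proof -
  obtain S where S: "S \<in> bounded_ops H"
    "\<forall>x\<in>carrier H. \<forall>y\<in>carrier H. hinner H (T x) y = hinner H x (S y)"
    using adjoint_exists[OF assms] by blast
  then have "op_adjoint H T = S" by (intro op_adjoint_eqI) auto
  then show "op_adjoint H T \<in> bounded_ops H"
    "\<lbrakk>x \<in> carrier H; y \<in> carrier H\<rbrakk> \<Longrightarrow> hinner H (T x) y = hinner H x (op_adjoint H T y)"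
    using S by auto
qed

lemma op_adjoint_closed:
  "\<lbrakk>T \<in> bounded_ops H; x \<in> carrier H\<rbrakk> \<Longrightarrow> op_adjoint H T x \<in> carrier H"
  by (rule bounded_op_closed[OF op_adjoint_bounded])

lemma op_adjoint_scale:
  assumes T: "T \<in> bounded_ops H"
  shows "op_adjoint H (op_scale H c T) = op_scale H (cnj c) (op_adjoint H T)"
proof (rule op_adjoint_eqI)
  fix x y assume "x \<in> carrier H" "y \<in> carrier H"
  then show "hinner H (op_scale H c T x) y = hinner H x (op_scale H (cnj c) (op_adjoint H T) y)"
    using T by (simp add: hinner_op_scale hinner_op_adjoint op_scale_def hinner_scale_right
        bounded_op_closed op_adjoint_closed hinner_scale_left)
qed (use T in \<open>auto intro: op_scale_bounded op_adjoint_bounded\<close>)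

section \<open>The map \<Phi> at nilpotent tuples\<close>

lemma is_Phi_unique:
  assumes "is_Phi H a X Y Z" "is_Phi H a X Y Z'"
  shows "Z = Z'"
proof (rule operator_eqI)
  fix x y assume xy: "x \<in> carrier H" "y \<in> carrier H"
  show "hinner H (Z x) y = hinner H (Z' x) y"
    using assms xy unfolding is_Phi_def by (meson sums_unique2)
qed (use assms in \<open>auto simp: is_Phi_def\<close>)

lemma Phi_eq: "is_Phi H a X Y Z \<Longrightarrow> Phi H a X Y = Z"
  unfolding Phi_def using is_Phi_unique by blast

text \<open>Terms with |\<alpha>| \<ge> p vanish, so the series is finite and defines a bounded
  operator for every bounded Y. The index k stands for words of length k + 1; thus k < p reaches
  length p, where the terms are already zero.\<close>

lemma is_Phi_nilpotent:
  fixes X :: "'n::finite \<Rightarrow> 'a \<Rightarrow> 'a"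
  assumes X: "range X \<subseteq> bounded_ops H" "nilpotent_order p X" and Y: "Y \<in> bounded_ops H"
  shows is_Phi_Phi: "is_Phi H a X Y (Phi H a X Y)"
    and hinner_Phi: "\<lbrakk>x \<in> carrier H; y \<in> carrier H\<rbrakk> \<Longrightarrow> hinner H (Phi H a X Y x) y =
      (\<Sum>k<p. \<Sum>\<alpha> | length \<alpha> = Suc k. of_real (a \<alpha>) *
        hinner H (Y (op_adjoint H (op_word H X \<alpha>) x)) (op_adjoint H (op_word H X \<alpha>) y))"
proof -
  let ?N = "op_word H X"
  let ?T = "\<lambda>\<alpha>. compose (carrier H) (?N \<alpha>) (compose (carrier H) Y (op_adjoint H (?N \<alpha>)))"
  have N: "?N \<alpha> \<in> bounded_ops H" for \<alpha> by (rule op_word_bounded[OF X(1)])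
  have T: "?T \<alpha> \<in> bounded_ops H" for \<alpha>
    by (intro compose_bounded N Y op_adjoint_bounded)
  have "\<forall>k. \<exists>Z\<in>bounded_ops H. \<forall>x\<in>carrier H. \<forall>y\<in>carrier H. hinner H (Z x) y =
      (\<Sum>\<alpha> | length \<alpha> = Suc k. of_real (a \<alpha>) * hinner H (?T \<alpha> x) y)"
    by (intro allI linear_combination_exists T) simp
  from choice[OF this[unfolded Bex_def]] obtain Z where Z0: "\<forall>k. Z k \<in> bounded_ops H \<and>
      (\<forall>x\<in>carrier H. \<forall>y\<in>carrier H. hinner H (Z k x) y =
        (\<Sum>\<alpha> | length \<alpha> = Suc k. of_real (a \<alpha>) * hinner H (?T \<alpha> x) y))" ..
  then have Z: "Z k \<in> bounded_ops H"
    "\<lbrakk>x \<in> carrier H; y \<in> carrier H\<rbrakk> \<Longrightarrow> hinner H (Z k x) y =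
      (\<Sum>\<alpha> | length \<alpha> = Suc k. of_real (a \<alpha>) * hinner H (?T \<alpha> x) y)" for k x y
    by simp_all
  obtain W where W: "W \<in> bounded_ops H" "\<And>x y. \<lbrakk>x \<in> carrier H; y \<in> carrier H\<rbrakk> \<Longrightarrow>
      hinner H (W x) y = (\<Sum>k<p. hinner H (Z k x) y)"
    using linear_combination_exists[of "{..<p}" Z "\<lambda>_. 1"] Z(1) by auto
  have term_zero: "hinner H (?N \<alpha> (Y (op_adjoint H (?N \<alpha>) x))) y = 0"
    if "p \<le> length \<alpha>" "x \<in> carrier H" "y \<in> carrier H" for \<alpha> x y
    using that nilpotent_order_apply[OF X(2) that(1)]
    by (simp add: bounded_op_closed[OF Y] op_adjoint_closed[OF N])
  have is_Phi: "is_Phi H a X Y W"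
    unfolding is_Phi_def
  proof (intro conjI ballI W(1))
    fix x y assume xy: "x \<in> carrier H" "y \<in> carrier H"
    let ?f = "\<lambda>k. \<Sum>\<alpha> | length \<alpha> = Suc k. of_real (a \<alpha>) *
        hinner H (?N \<alpha> (Y (op_adjoint H (?N \<alpha>) x))) y"
    have "hinner H (W x) y = (\<Sum>k<p. ?f k)"
      using xy by (simp add: W(2) Z(2) compose_def)
    moreover have "?f sums (\<Sum>k<p. ?f k)"
      by (rule sums_finite) (auto intro!: sum.neutral simp: term_zero xy)
    ultimately show "?f sums hinner H (W x) y" by simp
  qed
  then have W_eq: "Phi H a X Y = W" by (rule Phi_eq)
  show "is_Phi H a X Y (Phi H a X Y)" using is_Phi W_eq by simp
  assume xy: "x \<in> carrier H" "y \<in> carrier H"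
  have "hinner H (?T \<alpha> x) y
      = hinner H (Y (op_adjoint H (?N \<alpha>) x)) (op_adjoint H (?N \<alpha>) y)" for \<alpha>
    using xy by (simp add: compose_def hinner_op_adjoint[OF N] bounded_op_closed[OF Y]
        op_adjoint_closed[OF N])
  then show "hinner H (Phi H a X Y x) y =
      (\<Sum>k<p. \<Sum>\<alpha> | length \<alpha> = Suc k. of_real (a \<alpha>) *
        hinner H (Y (op_adjoint H (?N \<alpha>) x)) (op_adjoint H (?N \<alpha>) y))"
    using xy by (simp add: W_eq W(2) Z(2))
qed

lemma nc_domain_nilD:
  fixes X :: "'n::finite \<Rightarrow> 'a \<Rightarrow> 'a"
  assumes "X \<in> nc_domain_nil H a m"
  shows nc_domain_nil_bounded: "range X \<subseteq> bounded_ops H"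
    and nc_domain_nil_nilpotent: "nilpotent_tuple H X"
  using assms by (auto simp: nc_domain_nil_def nc_domain_def)

text \<open>The condition with \<open>k = 1\<close> gives \<open>a\<^bsub>g\<^sub>i\<^esub> X\<^sub>i X\<^sub>i\<^sup>* \<le> I\<close>.\<close>

lemma nc_domain_nil_entry_bound:
  fixes X :: "'n::finite \<Rightarrow> 'a \<Rightarrow> 'a"
  assumes a: "positive_regular a" and m: "m \<ge> 1" and XD: "X \<in> nc_domain_nil H a m"
    and x: "x \<in> carrier H" and y: "y \<in> carrier H"
  shows "cmod (hinner H (X i x) y) \<le> hnorm H x * (hnorm H y / sqrt (a [i]))"
proof -
  note X = nc_domain_nil_bounded[OF XD]
  have Xi: "X i \<in> bounded_ops H" by (rule range_subsetD[OF X])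
  obtain p where p: "nilpotent_order p X"
    using nilpotent_tuple_order[OF X nc_domain_nil_nilpotent[OF XD]] by blast
  let ?A = "\<lambda>\<alpha>. op_adjoint H (op_word H X \<alpha>)"
  have N: "op_word H X \<alpha> \<in> bounded_ops H" for \<alpha> by (rule op_word_bounded[OF X])
  have ai: "a [i] > 0" and a0: "a \<alpha> \<ge> 0" for \<alpha> using a by (auto simp: positive_regular_def)
  have idA: "op_id H (?A \<alpha> y) = ?A \<alpha> y" for \<alpha>
    using op_adjoint_closed[OF N y] by (simp add: op_id_def)
  have P: "Phi H a X (op_id H) \<in> bounded_ops H"
    using is_Phi_Phi[OF X p op_id_bounded] by (simp add: is_Phi_def)
  \<comment> \<open>\<open>S\<close> is the quadratic form of \<Phi>(I) at y. The domain condition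
    for k = 1 says S \<le> |y|^2, and as all summands are nonnegative the one for \<open>[i]\<close>
    bounds the adjoint of \<open>X i\<close> at y.\<close>
  define S where "S = (\<Sum>k<p. \<Sum>\<alpha> | length \<alpha> = Suc k. a \<alpha> * (hnorm H (?A \<alpha> y))\<^sup>2)"
  have "hinner H (Phi H a X (op_id H) y) y = of_real S"
    by (simp add: hinner_Phi[OF X p op_id_bounded y y] idA hinner_self[OF op_adjoint_closed[OF N y]]
        S_def)
  moreover have "hinner H (op_diff H (op_id H) (Phi H a X (op_id H)) y) y \<in> \<real>\<^sub>\<ge>\<^sub>0"
  proof -
    have "\<forall>k\<in>{1..m}. op_nonneg H (((\<lambda>Y. op_diff H Y (Phi H a X Y)) ^^ k) (op_id H))"
      using XD by (simp add: nc_domain_nil_def nc_domain_def)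
    from bspec[OF this, of 1] show ?thesis using m y by (simp add: op_nonneg_def)
  qed
  moreover have "op_id H y = y" using y by (simp add: op_id_def)
  ultimately have "of_real ((hnorm H y)\<^sup>2 - S) \<in> (\<real>\<^sub>\<ge>\<^sub>0 :: complex set)"
    by (simp only: hinner_op_diff[OF op_id_bounded P y y] hinner_self[OF y] of_real_diff)
  then have S_le: "S \<le> (hnorm H y)\<^sup>2"
    by (simp only: nonneg_Reals_of_real_iff diff_ge_0_iff_ge)
  have Ai: "op_adjoint H (X i) y \<in> carrier H" by (rule op_adjoint_closed[OF Xi y])
  have "a [i] * (hnorm H (op_adjoint H (X i) y))\<^sup>2 \<le> S"
  proof (cases "p = 1")
    case True
    have "X i = op_zero H"
      using p op_word_single[OF X, of i] True by (simp add: nilpotent_order_def)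
    then have "\<And>x. x \<in> carrier H \<Longrightarrow> hinner H x (op_adjoint H (X i) y) = 0"
      using hinner_op_adjoint[OF Xi _ y, symmetric] y by (simp add: op_zero_def)
    then have "hinner H (op_adjoint H (X i) y) (op_adjoint H (X i) y) = 0" using Ai by blast
    then have "(hnorm H (op_adjoint H (X i) y))\<^sup>2 = 0" unfolding hinner_self[OF Ai] by simp
    then show ?thesis unfolding S_def using a0 by (auto intro!: sum_nonneg)
  next
    case False
    have "a [i] * (hnorm H (op_adjoint H (X i) y))\<^sup>2
        = (\<Sum>\<alpha>\<in>{[i]}. a \<alpha> * (hnorm H (?A \<alpha> y))\<^sup>2)"
      by (simp add: op_word_single[OF X])
    also have "\<dots> \<le> (\<Sum>\<alpha> | length \<alpha> = Suc 0. a \<alpha> * (hnorm H (?A \<alpha> y))\<^sup>2)"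
      using a0 by (intro sum_mono2) auto
    also have "\<dots> = (\<Sum>k\<in>{0}. \<Sum>\<alpha> | length \<alpha> = Suc k. a \<alpha> * (hnorm H (?A \<alpha> y))\<^sup>2)"
      by simp
    also have "\<dots> \<le> S"
      unfolding S_def using a0 p by (intro sum_mono2) (auto intro!: sum_nonneg simp: nilpotent_order_def)
    finally show ?thesis .
  qed
  then have "a [i] * (hnorm H (op_adjoint H (X i) y))\<^sup>2 \<le> (hnorm H y)\<^sup>2" using S_le by linarith
  then have "(hnorm H (op_adjoint H (X i) y))\<^sup>2 \<le> (hnorm H y / sqrt (a [i]))\<^sup>2"
    using ai by (simp add: power_divide field_simps)
  then have "hnorm H (op_adjoint H (X i) y) \<le> hnorm H y / sqrt (a [i])"
    by (rule power2_le_imp_le) (use hnorm_nonneg[OF y] ai in simp)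
  then have "hnorm H x * hnorm H (op_adjoint H (X i) y) \<le> hnorm H x * (hnorm H y / sqrt (a [i]))"
    by (rule mult_left_mono[OF _ hnorm_nonneg[OF x]])
  then show ?thesis
    using Cauchy_Schwarz[OF x Ai] unfolding hinner_op_adjoint[OF Xi x y] by linarith
qed

text \<open>The word X_\<alpha> contributes c^|\<alpha>| and its adjoint the conjugate factor; for
  |c| = 1 they cancel term by term.\<close>

lemma is_Phi_rotate:
  fixes X :: "'n::finite \<Rightarrow> 'a \<Rightarrow> 'a"
  assumes X: "range X \<subseteq> bounded_ops H" and c: "cmod c = 1" and Y: "Y \<in> bounded_ops H"
  shows "is_Phi H a (\<lambda>i. op_scale H c (X i)) Y Z \<longleftrightarrow> is_Phi H a X Y Z"
proof -
  let ?cX = "\<lambda>i. op_scale H c (X i)"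
  have N: "op_word H X \<alpha> \<in> bounded_ops H" for \<alpha> by (rule op_word_bounded[OF X])
  have "hinner H (op_word H ?cX \<alpha> (Y (op_adjoint H (op_word H ?cX \<alpha>) x))) y
      = hinner H (op_word H X \<alpha> (Y (op_adjoint H (op_word H X \<alpha>) x))) y"
    if xy: "x \<in> carrier H" "y \<in> carrier H" for x y \<alpha>
  proof -
    let ?b = "c ^ length \<alpha>"
    let ?v = "Y (op_adjoint H (op_word H X \<alpha>) x)"
    have v: "?v \<in> carrier H"
      by (intro bounded_op_closed[OF Y] op_adjoint_closed[OF N] xy)
    have "op_adjoint H (op_word H ?cX \<alpha>) x = cnj ?b \<odot>\<^bsub>H\<^esub> op_adjoint H (op_word H X \<alpha>) x"
      unfolding op_word_scale[OF X] op_adjoint_scale[OF N] using xy by (simp add: op_scale_def)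
    then have "Y (op_adjoint H (op_word H ?cX \<alpha>) x) = cnj ?b \<odot>\<^bsub>H\<^esub> ?v"
      using bounded_op_scale[OF Y op_adjoint_closed[OF N xy(1)]] by simp
    then have "hinner H (op_word H ?cX \<alpha> (Y (op_adjoint H (op_word H ?cX \<alpha>) x))) y
        = ?b * (cnj ?b * hinner H (op_word H X \<alpha> ?v) y)"
      unfolding op_word_scale[OF X]
      using v xy bounded_op_closed[OF N v]
      by (simp only: hinner_op_scale[OF N smult_carrier[OF v] xy(2)] bounded_op_scale[OF N v]
          hinner_scale_left)
    also have "\<dots> = (?b * cnj ?b) * hinner H (op_word H X \<alpha> ?v) y" by (simp only: mult.assoc)
    also have "?b * cnj ?b = 1"
      by (simp only: complex_norm_square[symmetric] norm_power c power_one of_real_1)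
    finally show ?thesis by simp
  qed
  then show ?thesis unfolding is_Phi_def by simp
qed

lemma nc_domain_nil_rotate:
  fixes X :: "'n::finite \<Rightarrow> 'a \<Rightarrow> 'a"
  assumes XD: "X \<in> nc_domain_nil H a m" and c: "cmod c = 1"
  shows "(\<lambda>i. op_scale H c (X i)) \<in> nc_domain_nil H a m"
proof -
  let ?cX = "\<lambda>i. op_scale H c (X i)"
  note X = nc_domain_nil_bounded[OF XD]
  obtain p where p: "nilpotent_order p X"
    using nilpotent_tuple_order[OF X nc_domain_nil_nilpotent[OF XD]] by blast
  have Phi: "Phi H a ?cX Y = Phi H a X Y" "op_diff H Y (Phi H a X Y) \<in> bounded_ops H"
    if Y: "Y \<in> bounded_ops H" for Y
  proof -
    show "Phi H a ?cX Y = Phi H a X Y"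
      unfolding Phi_def is_Phi_rotate[OF X c Y] ..
    show "op_diff H Y (Phi H a X Y) \<in> bounded_ops H"
      using is_Phi_Phi[OF X p Y] Y by (auto simp: is_Phi_def intro: op_diff_bounded)
  qed
  \<comment> \<open>Boundedness is carried through the induction because the invariance of \<Phi>
    under rotation is stated for bounded arguments.\<close>
  have iter: "((\<lambda>Y. op_diff H Y (Phi H a ?cX Y)) ^^ k) (op_id H)
        = ((\<lambda>Y. op_diff H Y (Phi H a X Y)) ^^ k) (op_id H) \<and>
      ((\<lambda>Y. op_diff H Y (Phi H a X Y)) ^^ k) (op_id H) \<in> bounded_ops H" for k
    by (induction k) (simp_all add: op_id_bounded Phi)
  have cX: "range ?cX \<subseteq> bounded_ops H" using X by (auto intro: op_scale_bounded)
  have pc: "nilpotent_order p ?cX" by (rule nilpotent_order_scale[OF X p])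
  have "op_nonneg H (((\<lambda>Y. op_diff H Y (Phi H a ?cX Y)) ^^ k) (op_id H))" if "k \<in> {1..m}" for k
    using XD that unfolding nc_domain_nil_def nc_domain_def conjunct1[OF iter] by blast
  then show ?thesis
    using cX is_Phi_Phi[OF cX pc] nilpotent_orderD[OF pc]
    unfolding nc_domain_nil_def nc_domain_def by blast
qed

text \<open>Scaling makes \<Phi> so small that (1 - k\<epsilon>) I \<le> (id - \<Phi>)^k(I) \<le> I
  for all k \<le> m, with m\<epsilon> \<le> 1. Hence all the defining positivity conditions
  hold.\<close>

lemma nc_domain_nil_small:
  fixes M :: "'n::finite \<Rightarrow> 'a \<Rightarrow> 'a"
  assumes a: "positive_regular a" and M: "range M \<subseteq> bounded_ops H" and nil: "nilpotent_tuple H M"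
  shows "\<exists>r>0. (\<lambda>i. op_scale H (of_real r) (M i)) \<in> nc_domain_nil H a m"
proof -
  obtain p where p: "nilpotent_order p M" using nilpotent_tuple_order[OF M nil] .
  have a0: "a \<alpha> \<ge> 0" for \<alpha> using a by (auto simp: positive_regular_def)
  have NM: "op_word H M \<alpha> \<in> bounded_ops H" for \<alpha> by (rule op_word_bounded[OF M])
  have "\<forall>\<alpha>. \<exists>C\<ge>0. \<forall>x\<in>carrier H. hnorm H (op_adjoint H (op_word H M \<alpha>) x) \<le> C * hnorm H x"
  proof
    fix \<alpha>
    show "\<exists>C\<ge>0. \<forall>x\<in>carrier H. hnorm H (op_adjoint H (op_word H M \<alpha>) x) \<le> C * hnorm H x"
      by (rule bounded_op_bound[OF op_adjoint_bounded[OF NM]]) blast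
  qed
  from choice[OF this] obtain C where C0: "\<forall>\<alpha>. C \<alpha> \<ge> 0 \<and>
    (\<forall>x\<in>carrier H. hnorm H (op_adjoint H (op_word H M \<alpha>) x) \<le> C \<alpha> * hnorm H x)" ..
  \<comment> \<open>\<open>B\<close> bounds \<Phi>(I) for the unscaled tuple M. The choice of
    \<open>r\<close> gives r \<le> 1 and m r B \<le> 1, and \<epsilon> = r B will bound \<Phi>(Y)
    for the scaled tuple whenever 0 \<le> Y \<le> I.\<close>
  define B where "B = (\<Sum>k<p. \<Sum>\<alpha> | length \<alpha> = Suc k. a \<alpha> * (C \<alpha>)\<^sup>2)"
  define r where "r = inverse (1 + real m * B)"
  define \<epsilon> where "\<epsilon> = r * B"
  have B: "B \<ge> 0" unfolding B_def using a0 by (auto intro!: sum_nonneg)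
  have r: "0 < r" "r \<le> 1" using B by (auto simp: r_def add_pos_nonneg inverse_le_1_iff)
  have \<epsilon>: "0 \<le> \<epsilon>" "real m * \<epsilon> \<le> 1"
    using B r by (auto simp: \<epsilon>_def r_def field_simps add_pos_nonneg)
  let ?X = "\<lambda>i. op_scale H (of_real r) (M i)"
  have X: "range ?X \<subseteq> bounded_ops H" using M by (auto intro: op_scale_bounded)
  have pX: "nilpotent_order p ?X" by (rule nilpotent_order_scale[OF M p])
  let ?A = "\<lambda>\<alpha>. op_adjoint H (op_word H ?X \<alpha>)"
  have A: "?A \<alpha> x \<in> carrier H" if "x \<in> carrier H" for \<alpha> x
    by (rule op_adjoint_closed[OF op_word_bounded[OF X] that])
  have A_le: "(hnorm H (?A \<alpha> x))\<^sup>2 \<le> r * (C \<alpha>)\<^sup>2 * (hnorm H x)\<^sup>2"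
    if x: "x \<in> carrier H" and \<alpha>: "length \<alpha> = Suc k" for \<alpha> x k
  proof -
    let ?n = "length \<alpha>"
    have "?A \<alpha> x = cnj (of_real r ^ ?n) \<odot>\<^bsub>H\<^esub> op_adjoint H (op_word H M \<alpha>) x"
      unfolding op_word_scale[OF M] op_adjoint_scale[OF NM] using x by (simp add: op_scale_def)
    then have "hnorm H (?A \<alpha> x) = r ^ ?n * hnorm H (op_adjoint H (op_word H M \<alpha>) x)"
      using r by (simp add: hnorm_scale[OF op_adjoint_closed[OF NM x]] norm_power)
    also have "\<dots> \<le> r ^ ?n * (C \<alpha> * hnorm H x)"
      using C0 x r by (intro mult_left_mono) auto
    finally have "(hnorm H (?A \<alpha> x))\<^sup>2 \<le> (r ^ ?n * (C \<alpha> * hnorm H x))\<^sup>2"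
      by (rule power_mono[OF _ hnorm_nonneg[OF A[OF x]]])
    also have "\<dots> = (r ^ ?n)\<^sup>2 * ((C \<alpha>)\<^sup>2 * (hnorm H x)\<^sup>2)" by (simp only: power_mult_distrib)
    \<comment> \<open>The full factor is r^(2|\<alpha>|). Only nonempty words occur and r \<le> 1,
      so a single factor r bounds it uniformly in \<alpha>.\<close>
    also have "\<dots> \<le> r * ((C \<alpha>)\<^sup>2 * (hnorm H x)\<^sup>2)"
    proof (rule mult_right_mono)
      have "(r ^ ?n)\<^sup>2 = r ^ Suc (2 * k + 1)" by (simp add: \<alpha> power2_eq_square mult_2 power_add)
      also have "\<dots> = r * r ^ (2 * k + 1)" by (rule power_Suc)
      also have "\<dots> \<le> r * 1" using r by (intro mult_left_mono power_le_one) auto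
      finally show "(r ^ ?n)\<^sup>2 \<le> r" by simp
    qed simp
    finally show ?thesis by (simp only: mult.assoc)
  qed
  let ?it = "\<lambda>k. ((\<lambda>Y. op_diff H Y (Phi H a ?X Y)) ^^ k) (op_id H)"
  \<comment> \<open>Both bounds are needed in the induction: the lower one keeps Y and hence
    \<Phi>(Y) nonnegative, the upper one gives \<Phi>(Y) \<le> \<epsilon> I. Subtracting \<Phi>(Y)
    therefore costs at most \<epsilon> per step and preserves the upper bound.\<close>
  have it: "?it k \<in> bounded_ops H \<and> (\<forall>x\<in>carrier H. \<exists>t. hinner H (?it k x) x = of_real t \<and>
      (1 - real k * \<epsilon>) * (hnorm H x)\<^sup>2 \<le> t \<and> t \<le> (hnorm H x)\<^sup>2)" if "k \<le> m" for k
    using that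
  proof (induction k)
    case 0
    have "hinner H (op_id H x) x = of_real ((hnorm H x)\<^sup>2)" if "x \<in> carrier H" for x
      using hinner_self[OF that] that by (simp add: op_id_def)
    then have "\<exists>t. hinner H (op_id H x) x = of_real t \<and> (hnorm H x)\<^sup>2 \<le> t \<and> t \<le> (hnorm H x)\<^sup>2"
      if "x \<in> carrier H" for x
      using that by blast
    then show ?case using op_id_bounded by simp
  next
    case (Suc k)
    define Y where "Y = ?it k"
    define \<tau> where "\<tau> = (\<lambda>x. Re (hinner H (Y x) x))"
    note IH = conjunct2[OF Suc.IH[OF Suc_leD[OF Suc.prems]], folded Y_def]
    have Y: "Y \<in> bounded_ops H" using Suc by (simp add: Y_def)
    have P: "Phi H a ?X Y \<in> bounded_ops H"
      using is_Phi_Phi[OF X pX Y] by (simp add: is_Phi_def)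
    have \<tau>: "hinner H (Y x) x = of_real (\<tau> x)" "(1 - real k * \<epsilon>) * (hnorm H x)\<^sup>2 \<le> \<tau> x"
      "\<tau> x \<le> (hnorm H x)\<^sup>2" if "x \<in> carrier H" for x
    proof -
      from bspec[OF IH that] obtain t where t: "hinner H (Y x) x = of_real t" "(1 - real k * \<epsilon>) * (hnorm H x)\<^sup>2 \<le> t"
        "t \<le> (hnorm H x)\<^sup>2" by blast
      then have "\<tau> x = t" by (simp add: \<tau>_def)
      then show "hinner H (Y x) x = of_real (\<tau> x)" "(1 - real k * \<epsilon>) * (hnorm H x)\<^sup>2 \<le> \<tau> x"
        "\<tau> x \<le> (hnorm H x)\<^sup>2" using t by auto
    qed
    have "real k * \<epsilon> \<le> real m * \<epsilon>" using Suc.prems \<epsilon>(1) by (intro mult_right_mono) auto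
    then have "0 \<le> (1 - real k * \<epsilon>) * (hnorm H x)\<^sup>2" for x using \<epsilon>(2) by simp
    then have \<tau>0: "0 \<le> \<tau> x" if "x \<in> carrier H" for x using \<tau>(2)[OF that] order_trans by blast
    have "\<exists>t. hinner H (?it (Suc k) x) x = of_real t \<and>
      (1 - real (Suc k) * \<epsilon>) * (hnorm H x)\<^sup>2 \<le> t \<and> t \<le> (hnorm H x)\<^sup>2" if x: "x \<in> carrier H" for x
    proof (intro exI conjI)
      define S where "S = (\<Sum>k<p. \<Sum>\<alpha> | length \<alpha> = Suc k. a \<alpha> * \<tau> (?A \<alpha> x))"
      have S0: "0 \<le> S" unfolding S_def using a0 \<tau>0[OF A[OF x]] by (auto intro!: sum_nonneg)
      have "S \<le> (\<Sum>k<p. \<Sum>\<alpha> | length \<alpha> = Suc k. a \<alpha> * (r * (C \<alpha>)\<^sup>2 * (hnorm H x)\<^sup>2))"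
        unfolding S_def
      proof (intro sum_mono mult_left_mono a0)
        fix j \<alpha> assume "\<alpha> \<in> {\<alpha> :: 'n list. length \<alpha> = Suc j}"
        then show "\<tau> (?A \<alpha> x) \<le> r * (C \<alpha>)\<^sup>2 * (hnorm H x)\<^sup>2"
          using A_le[OF x, of \<alpha> j] \<tau>(3)[OF A[OF x], of \<alpha>] by simp
      qed
      also have "\<dots> = \<epsilon> * (hnorm H x)\<^sup>2"
        by (simp add: \<epsilon>_def B_def sum_distrib_left sum_distrib_right mult_ac)
      finally have S1: "S \<le> \<epsilon> * (hnorm H x)\<^sup>2" .
      have "hinner H (Phi H a ?X Y x) x = of_real S"
        by (simp add: hinner_Phi[OF X pX Y x x] \<tau>(1)[OF A[OF x]] S_def)
      then show "hinner H (?it (Suc k) x) x = of_real (\<tau> x - S)"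
        by (simp add: Y_def[symmetric] hinner_op_diff[OF Y P x x] \<tau>(1)[OF x])
      show "\<tau> x - S \<le> (hnorm H x)\<^sup>2" using S0 \<tau>(3)[OF x] by simp
      have "(1 - real (Suc k) * \<epsilon>) * (hnorm H x)\<^sup>2
          = (1 - real k * \<epsilon>) * (hnorm H x)\<^sup>2 - \<epsilon> * (hnorm H x)\<^sup>2" by (simp add: algebra_simps)
      then show "(1 - real (Suc k) * \<epsilon>) * (hnorm H x)\<^sup>2 \<le> \<tau> x - S"
        using S1 \<tau>(2)[OF x] by linarith
    qed
    moreover have "?it (Suc k) \<in> bounded_ops H"
      using op_diff_bounded[OF Y P] by (simp add: Y_def)
    ultimately show ?case by blast
  qed
  have "op_nonneg H (?it k)" if "k \<in> {1..m}" for k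
    unfolding op_nonneg_def
  proof
    fix x assume x: "x \<in> carrier H"
    have "k \<le> m" using that by simp
    from bspec[OF conjunct2[OF it[OF this]] x] obtain t where t: "hinner H (?it k x) x = of_real t" "(1 - real k * \<epsilon>) * (hnorm H x)\<^sup>2 \<le> t"
      by blast
    have "real k * \<epsilon> \<le> real m * \<epsilon>" using that \<epsilon>(1) by (intro mult_right_mono) auto
    then have "0 \<le> (1 - real k * \<epsilon>) * (hnorm H x)\<^sup>2" using \<epsilon>(2) by simp
    then have "0 \<le> t" using t(2) by linarith
    then show "hinner H (?it k x) x \<in> \<real>\<^sub>\<ge>\<^sub>0" unfolding t(1) by simp
  qed
  then have "?X \<in> nc_domain_nil H a m"
    using X is_Phi_Phi[OF X pX] nilpotent_orderD[OF pX]
    unfolding nc_domain_nil_def nc_domain_def by blast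
  then show ?thesis using r by blast
qed

end

section \<open>Shifts on finite-dimensional spaces\<close>

lemma cring_complex_ring: "cring complex_ring"
proof (rule cringI)
  show "abelian_group complex_ring"
    by (rule abelian_groupI) (auto simp: algebra_simps intro: exI[of _ "- _"])
  show "Group.comm_monoid complex_ring"
    by (rule Group.comm_monoidI) (auto simp: algebra_simps)
qed (auto simp: algebra_simps)

text \<open>The Hilbert space \<open>\<complex>\<^sup>d\<close>, carried over to the given type of vectors by an injection.\<close>

locale coordinate_space =
  fixes d :: nat and \<phi> :: "(nat \<Rightarrow> complex) \<Rightarrow> 'h"
  assumes inj: "inj_on \<phi> {v. \<forall>j\<ge>d. v j = 0}"
begin

section \<open>The Hilbert space structure of \<complex>^d\<close>

definition coord :: "'h \<Rightarrow> nat \<Rightarrow> complex" where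
  "coord = inv_into {v. \<forall>j\<ge>d. v j = 0} \<phi>"

text \<open>Sequences are truncated to d entries first, so that the operations of \<open>K\<close>
  can be written without conditions on supports and land in the set where \<phi> is
  injective.\<close>

definition vec :: "(nat \<Rightarrow> complex) \<Rightarrow> 'h" where
  "vec v = \<phi> (\<lambda>j. if j < d then v j else 0)"

definition K :: "'h hilbert" where
  "K = \<lparr>carrier = range vec, mult = undefined, one = undefined, zero = vec (\<lambda>_. 0),
     add = (\<lambda>x y. vec (\<lambda>j. coord x j + coord y j)),
     smult = (\<lambda>c x. vec (\<lambda>j. c * coord x j)),
     hinner = (\<lambda>x y. \<Sum>j<d. coord x j * cnj (coord y j))\<rparr>"

lemma vec_closed [simp]: "vec v \<in> carrier K"
  by (simp add: K_def)

lemma coord_vec: "coord (vec v) j = (if j < d then v j else 0)"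
  unfolding coord_def vec_def by (subst inv_into_f_f[OF inj]) auto

lemma coord_add: "j < d \<Longrightarrow> coord (x \<oplus>\<^bsub>K\<^esub> y) j = coord x j + coord y j"
  and coord_smult: "j < d \<Longrightarrow> coord (c \<odot>\<^bsub>K\<^esub> x) j = c * coord x j"
  and coord_zero: "coord \<zero>\<^bsub>K\<^esub> j = 0"
  by (simp_all add: K_def coord_vec)

lemma hinner_K: "hinner K x y = (\<Sum>j<d. coord x j * cnj (coord y j))"
  by (simp add: K_def)

lemma coord_eqI:
  assumes "x \<in> carrier K" "y \<in> carrier K" "\<And>j. j < d \<Longrightarrow> coord x j = coord y j"
  shows "x = y"
proof -
  obtain v w where v: "x = vec v" and w: "y = vec w" using assms(1,2) by (auto simp: K_def)
  have "(\<lambda>j. if j < d then v j else 0) = (\<lambda>j. if j < d then w j else 0)"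
    using assms(3) by (auto simp: v w coord_vec)
  then show ?thesis by (simp add: v w vec_def)
qed

lemma K_add_closed: "x \<oplus>\<^bsub>K\<^esub> y \<in> carrier K" and K_smult_closed: "c \<odot>\<^bsub>K\<^esub> x \<in> carrier K"
  and K_zero_closed: "\<zero>\<^bsub>K\<^esub> \<in> carrier K"
  by (auto simp: K_def)

lemma abelian_group_K: "abelian_group K"
proof (rule abelian_groupI)
  fix x assume x: "x \<in> carrier K"
  have "vec (\<lambda>j. - coord x j) \<oplus>\<^bsub>K\<^esub> x = \<zero>\<^bsub>K\<^esub>"
    by (rule coord_eqI) (auto simp: K_add_closed K_zero_closed coord_add coord_vec coord_zero)
  then show "\<exists>y\<in>carrier K. y \<oplus>\<^bsub>K\<^esub> x = \<zero>\<^bsub>K\<^esub>" by (rule bexI) simp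
  show "\<zero>\<^bsub>K\<^esub> \<oplus>\<^bsub>K\<^esub> x = x"
    by (rule coord_eqI) (auto simp: K_add_closed coord_add coord_zero x)
  fix y show "x \<oplus>\<^bsub>K\<^esub> y = y \<oplus>\<^bsub>K\<^esub> x"
    by (rule coord_eqI) (auto simp: K_add_closed coord_add)
  fix z show "x \<oplus>\<^bsub>K\<^esub> y \<oplus>\<^bsub>K\<^esub> z = x \<oplus>\<^bsub>K\<^esub> (y \<oplus>\<^bsub>K\<^esub> z)"
    by (rule coord_eqI) (auto simp: K_add_closed coord_add)
qed (auto simp: K_add_closed K_zero_closed)

lemma module_K: "Module.module complex_ring K"
proof (rule moduleI[OF cring_complex_ring abelian_group_K])
  fix a x y assume "x \<in> carrier K" "y \<in> carrier K"
  show "a \<odot>\<^bsub>K\<^esub> (x \<oplus>\<^bsub>K\<^esub> y) = a \<odot>\<^bsub>K\<^esub> x \<oplus>\<^bsub>K\<^esub> a \<odot>\<^bsub>K\<^esub> y"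
    by (rule coord_eqI) (auto simp: K_add_closed K_smult_closed coord_add coord_smult algebra_simps)
next
  fix a b x assume x: "x \<in> carrier K"
  show "(a \<oplus>\<^bsub>complex_ring\<^esub> b) \<odot>\<^bsub>K\<^esub> x = a \<odot>\<^bsub>K\<^esub> x \<oplus>\<^bsub>K\<^esub> b \<odot>\<^bsub>K\<^esub> x"
    by (rule coord_eqI) (auto simp: K_add_closed K_smult_closed coord_add coord_smult algebra_simps)
  show "(a \<otimes>\<^bsub>complex_ring\<^esub> b) \<odot>\<^bsub>K\<^esub> x = a \<odot>\<^bsub>K\<^esub> (b \<odot>\<^bsub>K\<^esub> x)"
    by (rule coord_eqI) (auto simp: K_smult_closed coord_smult)
  show "\<one>\<^bsub>complex_ring\<^esub> \<odot>\<^bsub>K\<^esub> x = x"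
    by (rule coord_eqI) (auto simp: K_smult_closed coord_smult x)
qed (auto simp: K_smult_closed)

lemma coord_diff:
  assumes "x \<in> carrier K" "y \<in> carrier K" "j < d"
  shows "coord (x \<ominus>\<^bsub>K\<^esub> y) j = coord x j - coord y j"
proof -
  interpret abelian_group K by (rule abelian_group_K)
  have "(x \<ominus>\<^bsub>K\<^esub> y) \<oplus>\<^bsub>K\<^esub> y = x" using assms by (simp add: minus_eq a_assoc l_neg)
  then have "coord (x \<ominus>\<^bsub>K\<^esub> y) j + coord y j = coord x j"
    using coord_add[OF assms(3), of "x \<ominus>\<^bsub>K\<^esub> y" y] by simp
  then show ?thesis by (simp add: algebra_simps)
qed

lemma hnorm_K: "hnorm K x = L2_set (\<lambda>j. cmod (coord x j)) {..<d}"
  by (simp add: hnorm_def hinner_K L2_set_def complex_norm_square[symmetric] del: of_real_power)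

lemma coord_le_hnorm: "j < d \<Longrightarrow> cmod (coord x j) \<le> hnorm K x"
  unfolding hnorm_K by (rule member_le_L2_set) auto

sublocale complex_hilbert_space K
proof (intro complex_hilbert_space.intro module_K complex_hilbert_space_axioms.intro)
  fix x y z c
  show "hinner K (x \<oplus>\<^bsub>K\<^esub> y) z = hinner K x z + hinner K y z"
    by (simp add: hinner_K coord_add distrib_right sum.distrib)
  show "hinner K (c \<odot>\<^bsub>K\<^esub> x) y = c * hinner K x y"
    by (simp add: hinner_K coord_smult sum_distrib_left mult.assoc)
  show "hinner K y x = cnj (hinner K x y)"
    by (simp add: hinner_K mult.commute)
  have xx: "hinner K x x = of_real (\<Sum>j<d. (cmod (coord x j))\<^sup>2)"
    by (simp only: hinner_K of_real_sum complex_norm_square)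
  show "hinner K x x \<in> \<real>\<^sub>\<ge>\<^sub>0"
    unfolding xx nonneg_Reals_of_real_iff by (intro sum_nonneg) simp
  assume x: "x \<in> carrier K" and "hinner K x x = 0"
  then have "(\<Sum>j<d. (cmod (coord x j))\<^sup>2) = 0" unfolding xx by (simp only: of_real_eq_0_iff)
  then have "coord x j = 0" if "j < d" for j
    using that by (simp add: sum_nonneg_eq_0_iff)
  then show "x = \<zero>\<^bsub>K\<^esub>" by (intro coord_eqI x K_zero_closed) (simp add: coord_zero)
next
  fix s :: "nat \<Rightarrow> 'h"
  assume s: "\<And>k. s k \<in> carrier K"
    and Cauchy: "\<And>e::real. e > 0 \<Longrightarrow> \<exists>N. \<forall>j\<ge>N. \<forall>k\<ge>N. hnorm K (s j \<ominus>\<^bsub>K\<^esub> s k) < e"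
  \<comment> \<open>Completeness is inherited from \<complex> coordinate by coordinate; the vector
    of the limits is the limit in norm.\<close>
  have "convergent (\<lambda>k. coord (s k) i)" if i: "i < d" for i
  proof (rule Cauchy_convergent, rule metric_CauchyI)
    fix e :: real assume "e > 0"
    then obtain N where "\<forall>j\<ge>N. \<forall>k\<ge>N. hnorm K (s j \<ominus>\<^bsub>K\<^esub> s k) < e" using Cauchy by blast
    then have "\<forall>j\<ge>N. \<forall>k\<ge>N. dist (coord (s j) i) (coord (s k) i) < e"
      using coord_le_hnorm[OF i] coord_diff[OF s s i] by (metis dist_norm le_less_trans)
    then show "\<exists>N. \<forall>j\<ge>N. \<forall>k\<ge>N. dist (coord (s j) i) (coord (s k) i) < e" by blast
  qed
  then obtain L where L: "\<And>i. i < d \<Longrightarrow> (\<lambda>k. coord (s k) i) \<longlonglongrightarrow> L i"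
    unfolding convergent_def by metis
  have "hnorm K (s k \<ominus>\<^bsub>K\<^esub> vec L) = L2_set (\<lambda>i. cmod (coord (s k) i - L i)) {..<d}" for k
    unfolding hnorm_K by (rule L2_set_cong) (auto simp: coord_diff s coord_vec)
  moreover have "(\<lambda>k. L2_set (\<lambda>i. cmod (coord (s k) i - L i)) {..<d}) \<longlonglongrightarrow> sqrt (\<Sum>i<d. 0\<^sup>2)"
    unfolding L2_set_def
    by (intro tendsto_intros tendsto_norm_zero) (auto intro: L simp: LIM_zero_iff)
  ultimately show "\<exists>x\<in>carrier K. (\<lambda>k. hnorm K (s k \<ominus>\<^bsub>K\<^esub> x)) \<longlonglongrightarrow> 0"
    by (intro bexI[of _ "vec L"]) simp_all
qed

section \<open>The standard basis, bounded operators and adjoints on \<complex>^d\<close>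

definition basis :: "nat \<Rightarrow> 'h" where
  "basis k = vec (\<lambda>j. if j = k then 1 else 0)"

lemma basis_closed [simp]: "basis k \<in> carrier K"
  by (simp add: basis_def)

lemma hinner_basis: "k < d \<Longrightarrow> hinner K (basis k) x = cnj (coord x k)"
  by (simp add: hinner_K basis_def coord_vec if_distrib[of "\<lambda>t. t * _"] cong: if_cong)

lemma linear_functional_expansion:
  assumes l: "linear_functional l" and x: "x \<in> carrier K"
  shows "l x = (\<Sum>k<d. coord x k * l (basis k))"
proof -
  have "x = (\<Oplus>\<^bsub>K\<^esub>k\<in>{..<d}. coord x k \<odot>\<^bsub>K\<^esub> basis k)"
  proof (rule vector_eqI[OF x])
    fix z assume z: "z \<in> carrier K"
    show "hinner K x z = hinner K (\<Oplus>\<^bsub>K\<^esub>k\<in>{..<d}. coord x k \<odot>\<^bsub>K\<^esub> basis k) z"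
      using z by (simp add: linear_functional_finsum[OF linear_functional_hinner]
          hinner_scale_left hinner_basis hinner_K[of x])
  qed auto
  then have "l x = l (\<Oplus>\<^bsub>K\<^esub>k\<in>{..<d}. coord x k \<odot>\<^bsub>K\<^esub> basis k)" by simp
  also have "\<dots> = (\<Sum>k<d. coord x k * l (basis k))"
    using l by (simp add: linear_functional_finsum[OF l]) (simp add: linear_functional_def)
  finally show ?thesis .
qed

text \<open>The Euclidean norm is at most the sum of the absolute values of the coordinates, so the
  sum of the absolute values of all matrix entries is a bound. Shifts and adjoints are both built
  from this.\<close>

lemma coordinate_op_bounded:
  assumes l: "\<And>j. j < d \<Longrightarrow> linear_functional (l j)"
  shows "(\<lambda>x\<in>carrier K. vec (\<lambda>j. l j x)) \<in> bounded_ops K"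
proof -
  let ?T = "\<lambda>x\<in>carrier K. vec (\<lambda>j. l j x)"
  let ?C = "\<Sum>j<d. \<Sum>k<d. cmod (l j (basis k))"
  show ?thesis
  proof (rule bounded_opsI[where C = ?C])
    fix x assume x: "x \<in> carrier K"
    show "?T (c \<odot>\<^bsub>K\<^esub> x) = c \<odot>\<^bsub>K\<^esub> ?T x" for c
      using x l by (intro coord_eqI) (auto simp: coord_vec coord_smult linear_functional_def)
    show "?T (x \<oplus>\<^bsub>K\<^esub> y) = ?T x \<oplus>\<^bsub>K\<^esub> ?T y" if "y \<in> carrier K" for y
      using x that l by (intro coord_eqI) (auto simp: coord_vec coord_add linear_functional_def)
    have "hnorm K (?T x) = L2_set (\<lambda>j. cmod (l j x)) {..<d}"
      unfolding hnorm_K using x by (intro L2_set_cong) (auto simp: coord_vec)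
    also have "\<dots> \<le> (\<Sum>j<d. cmod (l j x))" by (rule L2_set_le_sum) simp
    also have "\<dots> \<le> (\<Sum>j<d. (\<Sum>k<d. cmod (l j (basis k))) * hnorm K x)"
    proof (rule sum_mono)
      fix j assume "j \<in> {..<d}"
      then have "cmod (l j x) \<le> (\<Sum>k<d. cmod (coord x k * l j (basis k)))"
        using linear_functional_expansion[OF l x, of j] by (simp add: norm_sum)
      also have "\<dots> \<le> (\<Sum>k<d. cmod (l j (basis k)) * hnorm K x)"
        by (intro sum_mono) (auto simp: norm_mult mult.commute[of "cmod (l j _)"] intro!: mult_right_mono coord_le_hnorm)
      finally show "cmod (l j x) \<le> (\<Sum>k<d. cmod (l j (basis k))) * hnorm K x"
        by (simp add: sum_distrib_right)
    qed
    finally show "hnorm K (?T x) \<le> ?C * hnorm K x" by (simp add: sum_distrib_right)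
  qed auto
qed

sublocale hilbert_with_adjoints K
proof
  fix T assume T: "T \<in> bounded_ops K"
  \<comment> \<open>The conjugate transpose: the j-th coordinate of the adjoint at y is <y, T
    e_j>.\<close>
  define S where "S = (\<lambda>y\<in>carrier K. vec (\<lambda>j. hinner K y (T (basis j))))"
  have "S \<in> bounded_ops K"
    unfolding S_def
    by (intro coordinate_op_bounded linear_functional_hinner bounded_op_closed[OF T] basis_closed)
  moreover have "hinner K (T x) y = hinner K x (S y)" if x: "x \<in> carrier K" and y: "y \<in> carrier K" for x y
  proof -
    have "hinner K (T x) y = (\<Sum>k<d. coord x k * hinner K (T (basis k)) y)"
      by (rule linear_functional_expansion[OF linear_functional_comp[OF linear_functional_hinner[OF y] T] x])
    also have "\<dots> = (\<Sum>k<d. coord x k * cnj (coord (S y) k))"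
      using y hinner_cnj[OF y bounded_op_closed[OF T basis_closed]] by (simp add: S_def coord_vec)
    finally show ?thesis by (simp add: hinner_K[of x])
  qed
  ultimately show "\<exists>S\<in>bounded_ops K. \<forall>x\<in>carrier K. \<forall>y\<in>carrier K. hinner K (T x) y = hinner K x (S y)"
    by blast
qed

text \<open>The letters of \<alpha> label the steps of a path down the basis: operator i sends
  \<open>basis (Suc j)\<close> to \<open>basis j\<close> if the j-th letter is i and to zero
  otherwise. It is used with d = |\<alpha>| + 1, where the path has exactly |\<alpha>|
  steps.\<close>

definition shift :: "'n list \<Rightarrow> 'n \<Rightarrow> 'h \<Rightarrow> 'h" where
  "shift \<alpha> i = (\<lambda>x\<in>carrier K. vec (\<lambda>j. if Suc j < d \<and> \<alpha> ! j = i then coord x (Suc j) else 0))"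

lemma shift_bounded: "range (shift \<alpha>) \<subseteq> bounded_ops K"
  unfolding shift_def
  by (intro image_subsetI coordinate_op_bounded)
    (auto simp: linear_functional_def coord_add coord_smult)

text \<open>Applying \<beta> moves coordinate j + |\<beta>| to position j exactly if \<beta> spells
  the segment of \<alpha> beginning at j. The induction removes the first letter of \<beta>, which
  is the operator applied last, so j must be arbitrary.\<close>

lemma coord_op_word_shift:
  assumes x: "x \<in> carrier K" and \<alpha>: "d = Suc (length \<alpha>)" and "j < d"
  shows "coord (op_word K (shift \<alpha>) \<beta> x) j =
    (if j + length \<beta> < d \<and> \<beta> = take (length \<beta>) (drop j \<alpha>) then coord x (j + length \<beta>) else 0)"
  using assms(3)
proof (induction \<beta> arbitrary: j)
  case Nil
  then show ?case using x by (simp add: op_id_def)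
next
  case (Cons i \<beta>)
  have w: "op_word K (shift \<alpha>) \<beta> x \<in> carrier K" by (rule op_word_closed[OF shift_bounded x])
  have "coord (op_word K (shift \<alpha>) (i # \<beta>) x) j =
      (if Suc j < d \<and> \<alpha> ! j = i then coord (op_word K (shift \<alpha>) \<beta> x) (Suc j) else 0)"
    using x w Cons.prems by (simp add: op_word_Cons compose_def shift_def[of \<alpha> i] coord_vec)
  also have "\<dots> = (if j + length (i # \<beta>) < d \<and> i # \<beta> = take (length (i # \<beta>)) (drop j \<alpha>)
      then coord x (j + length (i # \<beta>)) else 0)"
  proof (cases "Suc j < d")
    case True
    then have "drop j \<alpha> = \<alpha> ! j # drop (Suc j) \<alpha>" using \<alpha> by (simp add: Cons_nth_drop_Suc)
    then show ?thesis using True Cons.IH[OF True] by auto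
  qed auto
  finally show ?case .
qed

lemma shift_nilpotent:
  assumes "d = Suc (length \<alpha>)" shows "nilpotent_tuple K (shift \<alpha>)"
proof -
  have "op_word K (shift \<alpha>) \<beta> = op_zero K" if "length \<beta> = d" for \<beta>
  proof (rule operator_eqI)
    fix x y assume x: "x \<in> carrier K" "y \<in> carrier K"
    have "op_word K (shift \<alpha>) \<beta> x = \<zero>\<^bsub>K\<^esub>"
      using x that by (intro coord_eqI op_word_closed[OF shift_bounded])
        (simp_all add: coord_op_word_shift[OF _ assms] coord_zero)
    then show "hinner K (op_word K (shift \<alpha>) \<beta> x) y = hinner K (op_zero K x) y"
      using x by (simp add: op_zero_def)
  qed (auto simp: op_word_bounded[OF shift_bounded] op_zero_bounded)
  then show ?thesis using assms by (auto simp: nilpotent_tuple_def intro!: exI[of _ d])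
qed

text \<open>Getting from the last basis vector to the first takes the whole path, and \<alpha> is
  the only word that spells it.\<close>

lemma hinner_op_word_shift:
  assumes "d = Suc (length \<alpha>)"
  shows "hinner K (op_word K (shift \<alpha>) \<beta> (basis (length \<alpha>))) (basis 0) = (if \<beta> = \<alpha> then 1 else 0)"
proof -
  let ?x = "op_word K (shift \<alpha>) \<beta> (basis (length \<alpha>))"
  have x: "?x \<in> carrier K" by (rule op_word_closed[OF shift_bounded basis_closed])
  have len: "length \<alpha> < d" "length \<beta> < d \<longleftrightarrow> length \<beta> \<le> length \<alpha>" using assms by auto
  have "hinner K ?x (basis 0) = coord ?x 0"
    using hinner_cnj[OF basis_closed x, of 0] hinner_basis[of 0 ?x] assms by simp
  also have "\<dots> = (if \<beta> = \<alpha> then 1 else 0)"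
    by (subst coord_op_word_shift[OF basis_closed assms]) (use len in \<open>auto simp: basis_def coord_vec\<close>)
  finally show ?thesis .
qed

end

text \<open>Coordinates are absorbed one at a time by an injection of \<complex> \<times> \<complex>
  into \<complex>, which exists because an infinite set is equinumerous with its square.\<close>

lemma inj_finite_sequences_complex:
  "\<exists>g :: (nat \<Rightarrow> complex) \<Rightarrow> complex. inj_on g {v. \<forall>j\<ge>d. v j = 0}"
proof (induction d)
  case 0
  have "inj_on (\<lambda>_. 0) {v :: nat \<Rightarrow> complex. \<forall>j\<ge>0. v j = 0}" by (auto simp: inj_on_def)
  then show ?case by blast
next
  case (Suc d)
  then obtain g :: "(nat \<Rightarrow> complex) \<Rightarrow> complex" where g: "inj_on g {v. \<forall>j\<ge>d. v j = 0}" by blast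
  have "infinite (UNIV :: complex set)" by (rule infinite_UNIV_char_0)
  from card_of_ordIso[THEN iffD2, OF card_of_Times_same_infinite[OF this]]
  obtain h :: "complex \<times> complex \<Rightarrow> complex" where "bij_betw h (UNIV \<times> UNIV) UNIV" by blast
  then have h: "inj h" by (simp add: bij_betw_def)
  have "inj_on (\<lambda>v. h (g (v(d := 0)), v d)) {v. \<forall>j\<ge>Suc d. v j = 0}"
  proof (rule inj_onI)
    fix v w :: "nat \<Rightarrow> complex"
    assume v: "v \<in> {v. \<forall>j\<ge>Suc d. v j = 0}" and w: "w \<in> {v. \<forall>j\<ge>Suc d. v j = 0}"
      and eq: "h (g (v(d := 0)), v d) = h (g (w(d := 0)), w d)"
    have eq: "g (v(d := 0)) = g (w(d := 0))" "v d = w d" using injD[OF h, OF eq] by simp_all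
    have "v(d := 0) = w(d := 0)" by (rule inj_onD[OF g, OF eq(1)]) (use v w in auto)
    then have "v(d := 0, d := v d) = w(d := 0, d := w d)" using eq(2) by simp
    then show "v = w" by simp
  qed
  then show ?case by (rule exI[where x = "\<lambda>v. h (g (v(d := 0)), v d)"])
qed

text \<open>The hypothesis on F concerns Hilbert spaces with vectors in the type of H, so
  \<complex>^d must be realised in that type. The multiples of a nonzero vector x supply room: c
  \<mapsto> c x is injective.\<close>

lemma (in complex_hilbert_space) inj_finite_sequences:
  assumes "infinite_dimensional H"
  shows "\<exists>\<phi> :: (nat \<Rightarrow> complex) \<Rightarrow> 'h. inj_on \<phi> {v. \<forall>j\<ge>d. v j = 0}"
proof -
  have "\<exists>x\<in>carrier H. x \<noteq> \<zero>\<^bsub>H\<^esub>"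
  proof (rule ccontr)
    assume "\<not> ?thesis"
    then have "\<forall>x\<in>carrier H. \<exists>c. x = (\<Oplus>\<^bsub>H\<^esub>b\<in>{}. c b \<odot>\<^bsub>H\<^esub> b)" by simp
    then show False using assms unfolding infinite_dimensional_def by blast
  qed
  then obtain x where x: "x \<in> carrier H" "x \<noteq> \<zero>\<^bsub>H\<^esub>" by blast
  have "inj (\<lambda>c. c \<odot>\<^bsub>H\<^esub> x)"
  proof (rule injI)
    fix b c assume "b \<odot>\<^bsub>H\<^esub> x = c \<odot>\<^bsub>H\<^esub> x"
    then have "b * hinner H x x = c * hinner H x x" using hinner_scale_left[OF x(1) x(1)] by metis
    then show "b = c" using hinner_definite[OF x(1)] x(2) by auto
  qed
  moreover obtain g :: "(nat \<Rightarrow> complex) \<Rightarrow> complex" where "inj_on g {v. \<forall>j\<ge>d. v j = 0}"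
    using inj_finite_sequences_complex by blast
  ultimately have "inj_on (\<lambda>v. g v \<odot>\<^bsub>H\<^esub> x) {v. \<forall>j\<ge>d. v j = 0}"
    by (auto simp: inj_on_def inj_def)
  then show ?thesis by (rule exI[where x = "\<lambda>v. g v \<odot>\<^bsub>H\<^esub> x"])
qed

text \<open>Evaluating a series at such a tuple and taking the matrix entry at x and y returns its
  coefficient at \<alpha>. This is the passage from operators back to coefficients.\<close>

lemma (in complex_hilbert_space) word_detecting_tuple_exists:
  fixes \<alpha> :: "'n list"
  assumes "infinite_dimensional H"
  shows "\<exists>(K :: 'h hilbert) M x y. hilbert_with_adjoints K \<and> range M \<subseteq> bounded_ops K \<and>
    nilpotent_tuple K M \<and> x \<in> carrier K \<and> y \<in> carrier K \<and>
    (\<forall>\<beta>. hinner K (op_word K M \<beta> x) y = (if \<beta> = \<alpha> then 1 else 0))"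
proof -
  obtain \<phi> :: "(nat \<Rightarrow> complex) \<Rightarrow> 'h" where "inj_on \<phi> {v. \<forall>j\<ge>Suc (length \<alpha>). v j = 0}"
    using inj_finite_sequences[OF assms] by blast
  then interpret C: coordinate_space "Suc (length \<alpha>)" \<phi> by unfold_locales
  show ?thesis
  proof (intro exI conjI allI)
    show "hilbert_with_adjoints C.K" by (rule C.hilbert_with_adjoints_axioms)
    show "range (C.shift \<alpha>) \<subseteq> bounded_ops C.K" by (rule C.shift_bounded)
    show "nilpotent_tuple C.K (C.shift \<alpha>)" by (rule C.shift_nilpotent[OF refl])
    show "C.basis (length \<alpha>) \<in> carrier C.K" "C.basis 0 \<in> carrier C.K" by (rule C.basis_closed)+
    show "hinner C.K (op_word C.K (C.shift \<alpha>) \<beta> (C.basis (length \<alpha>))) (C.basis 0)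
        = (if \<beta> = \<alpha> then 1 else 0)" for \<beta>
      by (rule C.hinner_op_word_shift[OF refl])
  qed
qed

section \<open>The self-maps of the domain\<close>

lemma ncps_word_single: "ncps_word S [j] = S j"
proof
  fix \<beta>
  have "ncps_word S [j] \<beta> = (\<Sum>k\<le>length \<beta>. S j (take k \<beta>) * (if drop k \<beta> = [] then 1 else 0))"
    by (simp add: ncps_word_def ncps_mult_def ncps_one_def)
  also have "\<dots> = (\<Sum>k\<in>{length \<beta>}. S j (take k \<beta>) * (if drop k \<beta> = [] then 1 else 0))"
    by (rule sum.mono_neutral_right) auto
  finally show "ncps_word S [j] \<beta> = S j \<beta>" by simp
qed

text \<open>Each factor must absorb at least one letter because S(0) = 0, so for equal lengths each
  absorbs exactly one and only the linear parts, which are the identity, matter.\<close>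

lemma ncps_word_same_length:
  assumes S0: "\<And>i. S i [] = 0" and S1: "\<And>i j. S i [j] = (if i = j then 1 else 0)"
    and "length \<alpha> = length \<beta>"
  shows "ncps_word S \<alpha> \<beta> = (if \<alpha> = \<beta> then 1 else 0)"
  using assms(3)
proof (induction \<alpha> arbitrary: \<beta>)
  case Nil
  then show ?case by (simp add: ncps_word_def ncps_one_def)
next
  case (Cons i \<alpha>)
  then obtain b \<beta>' where \<beta>: "\<beta> = b # \<beta>'" and len: "length \<alpha> = length \<beta>'" by (cases \<beta>) auto
  have "ncps_word S (i # \<alpha>) \<beta> = (\<Sum>k\<le>length \<beta>. S i (take k \<beta>) * ncps_word S \<alpha> (drop k \<beta>))"
    by (simp add: ncps_word_def ncps_mult_def)
  also have "\<dots> = (\<Sum>k\<in>{1}. S i (take k \<beta>) * ncps_word S \<alpha> (drop k \<beta>))"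
  proof (rule sum.mono_neutral_right)
    show "\<forall>k\<in>{..length \<beta>} - {1}. S i (take k \<beta>) * ncps_word S \<alpha> (drop k \<beta>) = 0"
    proof
      fix k assume k: "k \<in> {..length \<beta>} - {1}"
      show "S i (take k \<beta>) * ncps_word S \<alpha> (drop k \<beta>) = 0"
      proof (cases "k = 0")
        case False
        then have "length (drop k \<beta>) < length \<alpha>" using k len \<beta> by auto
        then show ?thesis by (simp add: ncps_word_eq_0[of S, OF S0])
      qed (simp add: S0)
    qed
  qed (auto simp: \<beta>)
  also have "\<dots> = (if i # \<alpha> = \<beta> then 1 else 0)" using Cons.IH[OF len] S1 by (simp add: \<beta>)
  finally show ?case .
qed

text \<open>Linear parts compose like matrices. This controls degree 1 of the twisted map and makes
  the linear part of F invertible.\<close>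

lemma ncps_compose_linear:
  fixes F G :: "'n::finite \<Rightarrow> 'n ncps"
  assumes "F i [] = 0"
  shows "ncps_compose F G i [j] = (\<Sum>k\<in>UNIV. F i [k] * G k [j])"
proof -
  have words: "{\<alpha> :: 'n list. length \<alpha> \<le> 1} = insert [] (range (\<lambda>k. [k]))"
    by (auto simp: le_Suc_eq length_Suc_conv)
  have "ncps_compose F G i [j] = (\<Sum>\<alpha>\<in>insert [] (range (\<lambda>k. [k])). F i \<alpha> * ncps_word G \<alpha> [j])"
    using words by (simp add: ncps_compose_def)
  also have "\<dots> = (\<Sum>\<alpha>\<in>range (\<lambda>k. [k]). F i \<alpha> * ncps_word G \<alpha> [j])"
    using assms by (subst sum.insert) auto
  also have "\<dots> = (\<Sum>k\<in>UNIV. F i [k] * ncps_word G [k] [j])"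
    by (subst sum.reindex) (auto simp: inj_on_def)
  finally show ?thesis by (simp add: ncps_word_single)
qed

text \<open>In degree q a composition T \<circ> S receives the coefficient of S through the linear
  term of T, and that of T itself through its words of length q, at which S acts as the identity.
  Degrees strictly between contribute nothing, so each iteration adds the same coefficient.\<close>

lemma ncps_compose_iterate:
  fixes T :: "'n::finite \<Rightarrow> 'n ncps"
  assumes T: "\<And>i \<gamma>. length \<gamma> < q \<Longrightarrow> T i \<gamma> = ncps_var i \<gamma>" and q: "q \<ge> 2"
  defines "S \<equiv> \<lambda>k. (ncps_compose T ^^ k) ncps_var"
  shows "(\<forall>i \<gamma>. length \<gamma> < q \<longrightarrow> S k i \<gamma> = ncps_var i \<gamma>) \<and>
    (\<forall>i \<beta>. length \<beta> = q \<longrightarrow> S k i \<beta> = of_nat k * T i \<beta>)"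
proof (induction k)
  case 0
  show ?case using q by (auto simp: S_def ncps_var_def)
next
  case (Suc k)
  then have low: "S k i \<gamma> = ncps_var i \<gamma>" if "length \<gamma> < q" for i \<gamma> using that by blast
  have S0: "S k i [] = 0" and S1: "S k i [j] = (if i = j then 1 else 0)" for i j
    using low[of "[]"] low[of "[j]"] q by (auto simp: ncps_var_def)
  have S_Suc: "S (Suc k) i \<beta> = (\<Sum>\<alpha> | length \<alpha> \<le> length \<beta>. T i \<alpha> * ncps_word (S k) \<alpha> \<beta>)" for i \<beta>
    by (simp add: S_def ncps_compose_def)
  have "S (Suc k) i \<gamma> = ncps_var i \<gamma>" if \<gamma>: "length \<gamma> < q" for i \<gamma>
  proof -
    have "S (Suc k) i \<gamma> = (\<Sum>\<alpha> | length \<alpha> \<le> length \<gamma>. if \<alpha> = [i] then S k i \<gamma> else 0)"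
      unfolding S_Suc using \<gamma> by (intro sum.cong) (auto simp: T ncps_var_def ncps_word_single)
    also have "\<dots> = ncps_var i \<gamma>"
      using low[OF \<gamma>] by (cases \<gamma>) (auto simp: sum.delta ncps_var_def)
    finally show ?thesis .
  qed
  moreover have "S (Suc k) i \<beta> = of_nat (Suc k) * T i \<beta>" if \<beta>: "length \<beta> = q" for i \<beta>
  proof -
    \<comment> \<open>The two surviving words are \<open>[i]\<close> and \<beta>; they are distinct
      because q \<ge> 2.\<close>
    have "S (Suc k) i \<beta> = (\<Sum>\<alpha> | length \<alpha> \<le> length \<beta>.
        (if \<alpha> = [i] then S k i \<beta> else 0) + (if \<alpha> = \<beta> then T i \<beta> else 0))"
      unfolding S_Suc
    proof (rule sum.cong[OF refl])
      fix \<alpha> :: "'n list" assume "\<alpha> \<in> {\<alpha>. length \<alpha> \<le> length \<beta>}"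
      then consider "length \<alpha> < q" | "length \<alpha> = length \<beta>" using \<beta> by force
      then show "T i \<alpha> * ncps_word (S k) \<alpha> \<beta> =
        (if \<alpha> = [i] then S k i \<beta> else 0) + (if \<alpha> = \<beta> then T i \<beta> else 0)"
      proof cases
        case 1
        then show ?thesis using \<beta> by (auto simp: T ncps_var_def ncps_word_single)
      next
        case 2
        then show ?thesis using \<beta> q by (auto simp: ncps_word_same_length[of "S k", OF S0 S1])
      qed
    qed
    also have "\<dots> = S k i \<beta> + T i \<beta>"
      using \<beta> q by (simp add: sum.distrib sum.delta)
    finally show ?thesis using Suc \<beta> by (simp add: algebra_simps)
  qed
  ultimately show ?case by blast
qed

text \<open>The formal series of c\<inverse> G \<circ> (c F). If G inverts F, it is the identity
  exactly when F commutes with multiplication by c, so it measures the failure of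
  homogeneity.\<close>

definition twist :: "complex \<Rightarrow> ('n::finite \<Rightarrow> 'n ncps) \<Rightarrow> ('n \<Rightarrow> 'n ncps) \<Rightarrow> 'n \<Rightarrow> 'n ncps" where
  "twist c F G = (\<lambda>i \<beta>. inverse c * ncps_compose G (\<lambda>j \<gamma>. c * F j \<gamma>) i \<beta>)"

text \<open>In degree 1 the scalars c and its inverse cancel, leaving the linear part of G \<circ> F
  = id.\<close>

lemma twist_low:
  assumes "c \<noteq> 0" "\<And>i. G i [] = 0" "ncps_compose G F = ncps_var" "length \<gamma> < 2"
  shows "twist c F G i \<gamma> = ncps_var i \<gamma>"
proof (cases \<gamma>)
  case Nil
  then show ?thesis using assms(2) by (simp add: twist_def ncps_compose_def ncps_var_def)
next
  case (Cons j \<gamma>')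
  then have \<gamma>: "\<gamma> = [j]" using assms(4) by simp
  have "inverse c * (G i [k] * (c * F k [j])) = G i [k] * F k [j]" for k
    using assms(1) by simp
  then have "twist c F G i [j] = (\<Sum>k\<in>UNIV. G i [k] * F k [j])"
    by (simp only: twist_def ncps_compose_linear[of G, OF assms(2)] sum_distrib_left)
  also have "\<dots> = ncps_compose G F i [j]" by (rule ncps_compose_linear[of G, OF assms(2), symmetric])
  finally show ?thesis using assms(3) \<gamma> by simp
qed

section \<open>Reading off one coefficient from a matrix entry\<close>

context complex_hilbert_space
begin

lemma ncps_eval_entry:
  assumes N: "range N \<subseteq> bounded_ops H" "nilpotent_tuple H N"
    and x: "x \<in> carrier H" and y: "y \<in> carrier H" and "s \<noteq> 0"
    and entry: "\<And>\<gamma>. hinner H (op_word H N \<gamma> x) y = (if \<gamma> = \<beta> then s else 0)"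
  shows "hinner H (ncps_eval H F N i x) y = F i \<beta> * s"
proof -
  obtain p where p: "nilpotent_order p N" using nilpotent_tuple_order[OF N] .
  \<comment> \<open>The nonzero entry s shows that \<beta> is among the words being summed.\<close>
  have "\<not> p \<le> length \<beta>"
    using nilpotent_order_apply[OF p _ x, of \<beta>] entry[of \<beta>] y \<open>s \<noteq> 0\<close> by auto
  have "hinner H (ncps_eval H F N i x) y
    = (\<Sum>\<gamma> | length \<gamma> < p. F i \<gamma> * hinner H (op_word H N \<gamma> x) y)"
    by (rule ncps_eval_functional[OF N(1) p linear_functional_hinner[OF y] x])
  also have "\<dots> = (\<Sum>\<gamma> | length \<gamma> < p. if \<gamma> = \<beta> then F i \<beta> * s else 0)"
    by (rule sum.cong) (auto simp: entry)
  also have "\<dots> = F i \<beta> * s" using \<open>\<not> p \<le> length \<beta>\<close> by (simp add: sum.delta)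
  finally show ?thesis .
qed

lemma op_scale_inverse:
  assumes "T \<in> bounded_ops H" "c \<noteq> 0"
  shows "op_scale H c (op_scale H (inverse c) T) = T"
proof (rule operator_eqI)
  fix x y assume "x \<in> carrier H" "y \<in> carrier H"
  then show "hinner H (op_scale H c (op_scale H (inverse c) T) x) y = hinner H (T x) y"
    using assms by (simp add: hinner_op_scale op_scale_bounded)
qed (use assms in \<open>auto intro: op_scale_bounded\<close>)

end

context hilbert_with_adjoints
begin

section \<open>The maps induced by F and G between the nilpotent domains\<close>

context
  fixes f g :: "'n::finite list \<Rightarrow> real" and m l :: nat and F G :: "'n \<Rightarrow> 'n ncps"
  assumes F0: "\<And>i. F i [] = 0" and GF: "ncps_compose G F = ncps_var"
    and image: "ncps_eval H F ` nc_domain_nil H f m = nc_domain_nil H g l"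
begin

text \<open>Surjectivity writes Q as F(N), and G \<circ> F = id recovers N. So G maps the second
  domain into the first, with F undoing it.\<close>

lemma ncps_eval_inverse:
  assumes "Q \<in> nc_domain_nil H g l"
  shows "ncps_eval H G Q \<in> nc_domain_nil H f m" "ncps_eval H F (ncps_eval H G Q) = Q"
proof -
  obtain N where N: "N \<in> nc_domain_nil H f m" and Q: "Q = ncps_eval H F N"
    using assms image by blast
  have "ncps_eval H G Q = ncps_eval H (ncps_compose G F) N"
    unfolding Q
    using nc_domain_nilD[OF N] nc_domain_nil_bounded[OF assms[unfolded Q]]
    by (intro ncps_eval_compose F0) auto
  then have "ncps_eval H G Q = N" using nc_domain_nilD[OF N] by (simp add: GF ncps_eval_var)
  then show "ncps_eval H G Q \<in> nc_domain_nil H f m" "ncps_eval H F (ncps_eval H G Q) = Q"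
    using N Q by auto
qed

text \<open>The twisted map factors as F into the second domain, rotation by c there, G back into
  the first, and rotation by the inverse of c. Every factor respects the domains.\<close>

lemma ncps_eval_twist:
  assumes N: "N \<in> nc_domain_nil H f m" and c: "cmod c = 1"
  defines "Q \<equiv> (\<lambda>j. op_scale H c (ncps_eval H F N j))"
  shows "Q \<in> nc_domain_nil H g l"
    and "ncps_eval H (twist c F G) N = (\<lambda>i. op_scale H (inverse c) (ncps_eval H G Q i))"
    and "ncps_eval H (twist c F G) N \<in> nc_domain_nil H f m"
proof -
  have "ncps_eval H F N \<in> nc_domain_nil H g l" using N image by blast
  then show Q: "Q \<in> nc_domain_nil H g l" unfolding Q_def by (rule nc_domain_nil_rotate[OF _ c])
  note N' = nc_domain_nilD[OF N]
  have cF: "ncps_eval H (\<lambda>j \<gamma>. c * F j \<gamma>) N = Q"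
    unfolding Q_def by (rule ncps_eval_scale[OF N'])
  have "ncps_eval H G Q = ncps_eval H (ncps_compose G (\<lambda>j \<gamma>. c * F j \<gamma>)) N"
    unfolding cF[symmetric]
    by (rule ncps_eval_compose[OF N']) (simp_all add: F0 cF nc_domain_nil_bounded[OF Q])
  then show eq: "ncps_eval H (twist c F G) N = (\<lambda>i. op_scale H (inverse c) (ncps_eval H G Q i))"
    unfolding twist_def ncps_eval_scale[OF N'] by simp
  show "ncps_eval H (twist c F G) N \<in> nc_domain_nil H f m"
    unfolding eq using ncps_eval_inverse(1)[OF Q] c
    by (intro nc_domain_nil_rotate) (simp_all add: norm_inverse)
qed

lemma ncps_eval_twist_iterate:
  assumes N: "N \<in> nc_domain_nil H f m" and c: "cmod c = 1"
    and S0: "\<And>k i. (ncps_compose (twist c F G) ^^ k) ncps_var i [] = 0"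
  shows "ncps_eval H ((ncps_compose (twist c F G) ^^ k) ncps_var) N \<in> nc_domain_nil H f m"
proof (induction k)
  case 0
  show ?case using N nc_domain_nilD[OF N] by (simp add: ncps_eval_var)
next
  case (Suc k)
  let ?S = "(ncps_compose (twist c F G) ^^ k) ncps_var"
  have "ncps_eval H (twist c F G) (ncps_eval H ?S N) = ncps_eval H (ncps_compose (twist c F G) ?S) N"
    by (rule ncps_eval_compose[OF nc_domain_nilD[OF N] nc_domain_nil_bounded[OF Suc] S0])
  then show ?case using ncps_eval_twist(3)[OF Suc c] by simp
qed

text \<open>A trivial twist says N = c\<inverse> G(c F(N)), that is c N = G(c F(N)); applying F
  gives F(c N) = c F(N).\<close>

lemma ncps_eval_rotate:
  assumes N: "N \<in> nc_domain_nil H f m" and c: "cmod c = 1" and T: "twist c F G = ncps_var"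
  shows "ncps_eval H F (\<lambda>i. op_scale H c (N i)) = (\<lambda>i. op_scale H c (ncps_eval H F N i))"
proof -
  define Q where "Q = (\<lambda>j. op_scale H c (ncps_eval H F N j))"
  note Q = ncps_eval_twist(1)[OF N c, folded Q_def]
  have "N = (\<lambda>i. op_scale H (inverse c) (ncps_eval H G Q i))"
    using ncps_eval_twist(2)[OF N c, folded Q_def] nc_domain_nilD[OF N] by (simp add: T ncps_eval_var)
  then have Ni: "N i = op_scale H (inverse c) (ncps_eval H G Q i)" for i by (rule fun_cong)
  have "c \<noteq> 0" using c by auto
  have "(\<lambda>i. op_scale H c (N i)) = ncps_eval H G Q"
    unfolding Ni
    using \<open>c \<noteq> 0\<close> op_scale_inverse[OF range_subsetD[OF nc_domain_nil_bounded[OF ncps_eval_inverse(1)[OF Q]]]]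
    by (intro ext) simp
  then show ?thesis using ncps_eval_inverse(2)[OF Q] by (simp add: Q_def)
qed

end

end

text \<open>A homogeneous component of lowest degree in which \<open>c\<inverse> G \<circ> (c F)\<close> differs from the identity
  would be multiplied by \<open>k\<close> in the \<open>k\<close>-th iterate, against the boundedness of the domain.\<close>

lemma twist_eq_var:
  fixes f g :: "'n::finite list \<Rightarrow> real"
    and H :: "'h hilbert"
    and F G :: "'n \<Rightarrow> 'n ncps"
  assumes f: "positive_regular f" and m: "m \<ge> 1"
    and H: "complex_hilbert_space H" "infinite_dimensional H"
    and F0: "\<And>i. F i [] = 0" and G0: "\<And>i. G i [] = 0" and GF: "ncps_compose G F = ncps_var"
    and image: "\<And>K :: 'h hilbert. complex_hilbert_space K \<Longrightarrow>
           ncps_eval K F ` nc_domain_nil K f m = nc_domain_nil K g l"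
    and c: "cmod c = 1"
  shows "twist c F G = ncps_var"
proof (rule ccontr)
  let ?T = "twist c F G"
  let ?P = "\<lambda>\<beta>. \<exists>i. ?T i \<beta> \<noteq> ncps_var i \<beta>"
  assume "?T \<noteq> ncps_var"
  then have "\<exists>\<beta>. ?P \<beta>" by (metis ext)
  then obtain \<beta> where \<beta>: "?P \<beta>" and min: "\<And>\<gamma>. ?P \<gamma> \<Longrightarrow> length \<beta> \<le> length \<gamma>"
    using ex_has_least_nat[of ?P _ length] by blast
  from \<beta> obtain i where i: "?T i \<beta> \<noteq> ncps_var i \<beta>" by blast
  have "c \<noteq> 0" using c by auto
  \<comment> \<open>In degrees 0 and 1 the twist agrees with the identity, so the first deviation
    has degree at least 2, where \<open>ncps_var\<close> has no coefficients.\<close>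
  then have q: "2 \<le> length \<beta>" using twist_low[of c G F \<beta> i, OF _ G0 GF] i by (meson not_le)
  have low: "?T j \<gamma> = ncps_var j \<gamma>" if "length \<gamma> < length \<beta>" for j \<gamma>
    using min[of \<gamma>] that by auto
  define S where "S = (\<lambda>k. (ncps_compose ?T ^^ k) ncps_var)"
  have S: "length \<gamma> < length \<beta> \<Longrightarrow> S k j \<gamma> = ncps_var j \<gamma>" "S k i \<beta> = of_nat k * ?T i \<beta>" for j k \<gamma>
    using ncps_compose_iterate[of "length \<beta>" ?T, OF low q, of k] by (simp_all add: S_def)
  have S0: "S k j [] = 0" for k j using S(1)[of "[]" k j] q by (cases \<beta>) (auto simp: ncps_var_def)
  have T\<beta>: "?T i \<beta> \<noteq> 0" using i q by (auto simp: ncps_var_def split: if_splits)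
  obtain K :: "'h hilbert" and M x y where "hilbert_with_adjoints K"
    and M: "range M \<subseteq> bounded_ops K" "nilpotent_tuple K M" and x: "x \<in> carrier K" and y: "y \<in> carrier K"
    and entry: "\<And>\<gamma>. hinner K (op_word K M \<gamma> x) y = (if \<gamma> = \<beta> then 1 else 0)"
    using complex_hilbert_space.word_detecting_tuple_exists[OF H, of \<beta>] by blast
  interpret hilbert_with_adjoints K by fact
  obtain r :: real where r: "r > 0" and N: "(\<lambda>i. op_scale K (of_real r) (M i)) \<in> nc_domain_nil K f m"
    using nc_domain_nil_small[OF f M] by blast
  let ?N = "\<lambda>i. op_scale K (of_real r) (M i)"
  have N_entry: "hinner K (op_word K ?N \<gamma> x) y = (if \<gamma> = \<beta> then of_real r ^ length \<beta> else 0)" for \<gamma>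
    by (simp add: op_word_scale[OF M(1)] hinner_op_scale[OF op_word_bounded[OF M(1)] x y] entry)
  \<comment> \<open>This bound holds for every tuple in the domain, hence for all iterates k at
    once.\<close>
  define B where "B = hnorm K x * (hnorm K y / sqrt (f [i]))"
  have "real k * cmod (?T i \<beta> * of_real r ^ length \<beta>) \<le> B" for k
  proof -
    have "ncps_eval K (S k) ?N \<in> nc_domain_nil K f m"
      using ncps_eval_twist_iterate[OF F0 GF image[OF complex_hilbert_space_axioms] N c S0[unfolded S_def]]
      by (simp add: S_def)
    then have "cmod (hinner K (ncps_eval K (S k) ?N i x) y) \<le> B"
      unfolding B_def by (rule nc_domain_nil_entry_bound[OF f m _ x y])
    moreover have "hinner K (ncps_eval K (S k) ?N i x) y = S k i \<beta> * of_real r ^ length \<beta>"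
      by (rule ncps_eval_entry[OF nc_domain_nilD[OF N] x y _ N_entry]) (use r in simp)
    ultimately show ?thesis by (simp add: S(2) norm_mult mult.assoc)
  qed
  moreover have "0 < cmod (?T i \<beta> * of_real r ^ length \<beta>)" using T\<beta> r by simp
  ultimately show False using reals_Archimedean3 by (metis not_le)
qed

section \<open>Vanishing of the higher coefficients and invertibility of the linear part\<close>

theorem theorem4p2:
  fixes f g :: "'n::finite list \<Rightarrow> real"
    and m l :: nat
    and H :: "'h hilbert"
    and F G :: "'n \<Rightarrow> 'n ncps"
  assumes "positive_regular f" and "positive_regular g"
    and "m \<ge> 1" and "l \<ge> 1"
    and "complex_hilbert_space H" and "separable_hilbert H" and "infinite_dimensional H"
    and "norm_closed H (nc_domain H f m)" and "starlike_ops H (nc_domain H f m)"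
    and "norm_closed H (nc_domain H g l)" and "starlike_ops H (nc_domain H g l)"
    and "\<forall>i. F i [] = 0" and "\<forall>i. G i [] = 0"
    and "ncps_compose F G = ncps_var" and "ncps_compose G F = ncps_var"
    and "\<forall>K :: 'h hilbert. complex_hilbert_space K \<longrightarrow>
           ncps_eval K F ` nc_domain_nil K f m = nc_domain_nil K g l"
  shows "\<exists>U :: complex^'n^'n. invertible U \<and> F = ncps_row_mult ncps_var U"
proof -
  have F0: "F i [] = 0" and G0: "G i [] = 0" for i using assms(12,13) by auto
  have image: "ncps_eval K F ` nc_domain_nil K f m = nc_domain_nil K g l"
    if "complex_hilbert_space K" for K :: "'h hilbert"
    using assms(16) that by blast
  have F_linear: "F i \<beta> = 0" if q: "2 \<le> length \<beta>" for i \<beta>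
  proof -
    \<comment> \<open>A root of c^(q-1) = -1 for q = |\<beta>|, well defined since q \<ge> 2. Then
      c^q = -c differs from c.\<close>
    define c where "c = cis (pi / real (length \<beta> - 1))"
    have c: "cmod c = 1" by (simp add: c_def)
    have "c ^ length \<beta> = c * c ^ (length \<beta> - 1)" using q by (cases "length \<beta>") auto
    also have "c ^ (length \<beta> - 1) = -1" using q by (simp add: c_def Complex.DeMoivre)
    finally have c_power: "c ^ length \<beta> = - c" by simp
    have T: "twist c F G = ncps_var"
      by (rule twist_eq_var[OF assms(1,3,5,7) F0 G0 assms(15) image c])
    obtain K :: "'h hilbert" and M x y where "hilbert_with_adjoints K"
      and M: "range M \<subseteq> bounded_ops K" "nilpotent_tuple K M"
      and x: "x \<in> carrier K" and y: "y \<in> carrier K"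
      and entry: "\<And>\<gamma>. hinner K (op_word K M \<gamma> x) y = (if \<gamma> = \<beta> then 1 else 0)"
      using complex_hilbert_space.word_detecting_tuple_exists[OF assms(5,7), of \<beta>] by blast
    interpret hilbert_with_adjoints K by fact
    obtain r :: real where r: "r > 0" and N: "(\<lambda>i. op_scale K (of_real r) (M i)) \<in> nc_domain_nil K f m"
      using nc_domain_nil_small[OF assms(1) M] by blast
    define N where "N = (\<lambda>i. op_scale K (of_real r) (M i))"
    note N = N[folded N_def]
    note N' = nc_domain_nilD[OF N]
    have N_entry: "hinner K (op_word K N \<gamma> x) y = (if \<gamma> = \<beta> then of_real r ^ length \<beta> else 0)" for \<gamma>
      by (simp add: N_def op_word_scale[OF M(1)] hinner_op_scale[OF op_word_bounded[OF M(1)] x y] entry)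
    have cN: "(\<lambda>i. op_scale K c (N i)) \<in> nc_domain_nil K f m"
      by (rule nc_domain_nil_rotate[OF N c])
    have cN_entry: "hinner K (op_word K (\<lambda>i. op_scale K c (N i)) \<gamma> x) y
        = (if \<gamma> = \<beta> then c ^ length \<beta> * of_real r ^ length \<beta> else 0)" for \<gamma>
      by (simp add: op_word_scale[OF N'(1)] hinner_op_scale[OF op_word_bounded[OF N'(1)] x y] N_entry)
    have FN: "ncps_eval K F N \<in> nc_domain_nil K g l"
      using N image[OF complex_hilbert_space_axioms] by blast
    have nz: "of_real r ^ length \<beta> \<noteq> (0 :: complex)" "c ^ length \<beta> * of_real r ^ length \<beta> \<noteq> 0"
      using r c by auto
    \<comment> \<open>The same entry of F(c N) = c F(N) is computed on both sides. The coefficient a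
      of F at \<beta> satisfies -c a = c a up to a common nonzero factor, hence a = 0.\<close>
    have "hinner K (ncps_eval K F (\<lambda>i. op_scale K c (N i)) i x) y
        = hinner K (op_scale K c (ncps_eval K F N i) x) y"
      using ncps_eval_rotate[OF F0 assms(15) image[OF complex_hilbert_space_axioms] N c T] by simp
    also have "\<dots> = c * hinner K (ncps_eval K F N i x) y"
      by (rule hinner_op_scale[OF range_subsetD[OF nc_domain_nil_bounded[OF FN]] x y])
    finally have "F i \<beta> * (c ^ length \<beta> * of_real r ^ length \<beta>) = c * (F i \<beta> * of_real r ^ length \<beta>)"
      by (simp only: ncps_eval_entry[OF N' x y nz(1) N_entry]
          ncps_eval_entry[OF nc_domain_nilD[OF cN] x y nz(2) cN_entry])
    then show ?thesis using nz unfolding c_power by (auto simp: algebra_simps)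
  qed
  \<comment> \<open>Column j holds the linear coefficients of \<open>F j\<close>, following the row
    convention [Z]U. Under it products reverse: \<open>U ** V\<close> is the linear part of G
    \<circ> F and \<open>V ** U\<close> that of F \<circ> G.\<close>
  define U :: "complex^'n^'n" where "U = (\<chi> k j. F j [k])"
  define V :: "complex^'n^'n" where "V = (\<chi> k j. G j [k])"
  have "(U ** V) $ a $ b = mat 1 $ a $ b" for a b
  proof -
    have "(U ** V) $ a $ b = ncps_compose G F b [a]"
      by (simp add: matrix_matrix_mult_def U_def V_def ncps_compose_linear[of G, OF G0] mult.commute)
    then show ?thesis using assms(15) by (simp add: ncps_var_def mat_def)
  qed
  moreover have "(V ** U) $ a $ b = mat 1 $ a $ b" for a b
  proof -
    have "(V ** U) $ a $ b = ncps_compose F G b [a]"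
      by (simp add: matrix_matrix_mult_def U_def V_def ncps_compose_linear[of F, OF F0] mult.commute)
    then show ?thesis using assms(14) by (simp add: ncps_var_def mat_def)
  qed
  ultimately have "U ** V = mat 1" "V ** U = mat 1" by (simp_all add: vec_eq_iff)
  then have "invertible U" unfolding invertible_def by blast
  moreover have "F = ncps_row_mult ncps_var U"
  proof (intro ext)
    fix j and \<alpha> :: "'n list"
    consider "\<alpha> = []" | k where "\<alpha> = [k]" | "2 \<le> length \<alpha>"
      by (cases \<alpha> rule: remdups_adj.cases) auto
    then show "F j \<alpha> = ncps_row_mult ncps_var U j \<alpha>"
    proof cases
      case 3
      then have "\<alpha> \<noteq> [k]" for k by auto
      then show ?thesis using F_linear[OF 3] by (simp add: ncps_row_mult_def ncps_var_def)
    qed (auto simp: F0 ncps_row_mult_def ncps_var_def U_def if_distrib cong: if_cong)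
  qed
  ultimately show ?thesis by blast
qed

end
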